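(* Let $\alpha, \lambda, \mu \in \mathbb{Q}$ satisfy $\alpha > 0$, $9\alpha + 27\lambda - 15\mu \geq 0$, and $18\alpha + 63\lambda - 35\mu = 0$. Let $[D]$ be an $F$-nef divisor class lying in the codimension one subspace of $N^1(\overline{M}_{0,7})_{\mathbb{Q}}$ generated by the classes $[S_I]$ ($I \subseteq \{1,\dots,7\}$, $|I| = 4$) and $[P_i]$ ($i=1,\dots,7$), written as $[D] = \sum_I s_I [S_I] + \sum_{i=1}^7 p_i [P_i]$ with $s_I, p_i \in \mathbb{Q}$. Then the representative $D = \sum_I s_I S_I + \sum_{i=1}^7 p_i P_i$ is an effective sum of boundary divisors: when it is written as $D = \sum_J c_J \Delta_J$ (as an equality of divisors, each boundary divisor appearing once), all $c_J \geq 0$.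
   Context: $\overline{M}_{0,7}$ is the moduli space of stable $7$-pointed rational curves, and $N^1(\overline{M}_{0,7})_{\mathbb{Q}}$ is its Néron–Severi space over $\mathbb{Q}$ (of dimension 42). For $J \subseteq \{1,\dots,7\}$ with $|J|, |J^c| \geq 2$, the boundary divisor $\Delta_J = \Delta_{J^c}$ is the closure of the locus of curves with two irreducible components, one carrying the marked points in $J$ and the other those in $J^c$; write $\Delta_{ij} = \Delta_{\{i,j\}}$. An $F$-curve is any curve numerically equivalent to a one-dimensional stratum (an irreducible component of the locus of curves with at least $7-4 = 3$ nodes); its numerical class is determined by a partition of $\{1,\dots,7\}$ into four nonempty subsets. A divisor class is $F$-nef if it intersects every $F$-curve non-negatively. For a four-element subset $I = \{i,j,k,l\} \subseteq \{1,\dots,7\}$, the Keel divisor is $$S_I = \frac{1}{3}\Big(\sum_{\{i,j\} \subseteq T,\ \{k,l\} \subseteq T^c} \Delta_T + \sum_{\{i,k\} \subseteq T,\ \{j,l\} \subseteq T^c} \Delta_T + \sum_{\{i,l\} \subseteq T,\ \{j,k\} \subseteq T^c} \Delta_T\Big),$$ where $T$ ranges over subsets of $\{1,\dots,7\}$ with $|T|,|T^c| \geq 2$. Put $B_2 = \sum_{|J|=2} \Delta_J$, $B_3 = \sum_{|J|=3} \Delta_J$, $D_i = \sum_{j \neq i} \Delta_{ij}$, and $$P_i = \alpha D_i + \lambda B_2 + \mu B_3, \qquad i = 1,\dots,7.$$ *)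

theory Defs
  imports "HOL-Analysis.Analysis"
begin

section \<open>Boundary divisors\<close>

text \<open>
  The marked points are the seven elements of the numeral type \<open>7\<close>, so \<open>- T\<close> is the complement of a
  set \<open>T\<close> of marked points. The boundary divisor \<open>\<Delta>\<^sub>T = \<Delta>\<^bsub>- T\<^esub>\<close> is identified with
  the unordered pair \<open>{T, - T}\<close>.
\<close>

typedef boundary = "{{T, - T} | T :: 7 set. 2 \<le> card T \<and> 2 \<le> card (- T)}"
  morphisms sides Abs_boundary
proof -
  obtain T :: "7 set" where "card T = 2"
    using ex_card[of 2 "UNIV :: 7 set"] by auto
  moreover from this have "card (- T) = 5"
    using card_Diff_subset[of T UNIV] by (simp flip: Compl_eq_Diff_UNIV)
  ultimately show ?thesis
    by (intro exI[of _ "{T, - T}"]) force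
qed

instance boundary :: finite
proof
  have "inj sides"
    by (meson injI sides_inject)
  then show "finite (UNIV :: boundary set)"
    using finite_imageD[of sides UNIV] finite_subset[OF subset_UNIV finite, of "range sides"] by blast
qed

text \<open>\<open>bd T\<close> is meaningful only if \<open>T\<close> and \<open>- T\<close> have at least two elements.\<close>

definition bd :: "7 set \<Rightarrow> boundary" where
  "bd T = Abs_boundary {T, - T}"

text \<open>
  A boundary divisor with rational coefficients is the vector of its coefficients: \<open>D $ J\<close> is the
  coefficient of \<open>D\<close> at the boundary divisor \<open>J\<close>.
\<close>

type_synonym divisor = "rat ^ boundary"

definition Delta :: "7 set \<Rightarrow> divisor" where
  "Delta T = axis (bd T) 1"

definition separating :: "7 set \<Rightarrow> 7 set \<Rightarrow> divisor" where
  "separating A B =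
    (\<Sum>T | 2 \<le> card T \<and> 2 \<le> card (- T) \<and> A \<subseteq> T \<and> B \<subseteq> - T. Delta T)"


section \<open>The Neron-Severi space\<close>

text \<open>
  By Keel's theorem the Picard group of the space of stable 7-pointed rational curves is generated by
  the boundary divisors, all relations between them follow from the linear equivalences below (the
  boundary points of the space of stable 4-pointed rational curves, which is a projective line, pulled
  back along the morphism that forgets all points but \<open>i, j, k, l\<close>), and linear and numerical
  equivalence coincide.
\<close>

definition keel_relations :: "divisor set" where
  "keel_relations =
    {separating {i, j} {k, l} - separating {i, k} {j, l} | i j k l. card {i, j, k, l} = 4}"

quotient_type NS = divisor / "\<lambda>D E :: divisor. D - E \<in> vec.span keel_relations"
  morphisms rep_NS cls
proof (rule equivpI)
  show "reflp (\<lambda>D E. D - E \<in> vec.span keel_relations)"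
    by (simp add: reflp_def vec.span_zero)
  show "symp (\<lambda>D E. D - E \<in> vec.span keel_relations)"
  proof (rule sympI)
    fix D E :: divisor
    assume "D - E \<in> vec.span keel_relations"
    then have "- (D - E) \<in> vec.span keel_relations"
      by (rule vec.span_neg)
    then show "E - D \<in> vec.span keel_relations"
      by simp
  qed
  show "transp (\<lambda>D E. D - E \<in> vec.span keel_relations)"
  proof (rule transpI)
    fix D E F :: divisor
    assume "D - E \<in> vec.span keel_relations" "E - F \<in> vec.span keel_relations"
    then have "(D - E) + (E - F) \<in> vec.span keel_relations"
      by (rule vec.span_add)
    then show "D - F \<in> vec.span keel_relations"
      by simp
  qed
qed

instantiation NS :: ab_group_add
begin

lift_definition zero_NS :: NS is 0 .

lift_definition plus_NS :: "NS \<Rightarrow> NS \<Rightarrow> NS" is "(+)"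
  by (simp only: add_diff_add vec.span_add)

lift_definition uminus_NS :: "NS \<Rightarrow> NS" is uminus
  by (simp only: minus_diff_minus vec.span_neg)

lift_definition minus_NS :: "NS \<Rightarrow> NS \<Rightarrow> NS" is "(-)"
proof -
  fix D D' E E' :: divisor
  assume "D - D' \<in> vec.span keel_relations" "E - E' \<in> vec.span keel_relations"
  then have "(D - D') - (E - E') \<in> vec.span keel_relations"
    by (rule vec.span_diff)
  moreover have "(D - D') - (E - E') = D - E - (D' - E')"
    by simp
  ultimately show "D - E - (D' - E') \<in> vec.span keel_relations"
    by simp
qed

instance
proof
  fix a b c :: NS
  show "a + b + c = a + (b + c)"
    by transfer (simp add: add.assoc vec.span_zero)
  show "a + b = b + a"
    by transfer (simp add: add.commute vec.span_zero)
  show "0 + a = a"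
    by transfer (simp add: vec.span_zero)
  show "- a + a = 0"
    by transfer (simp add: vec.span_zero)
  show "a - b = a + - b"
    by transfer (simp add: vec.span_zero)
qed

end

lift_definition nscale :: "rat \<Rightarrow> NS \<Rightarrow> NS"  (infixr \<open>*N\<close> 75) is "(*s)"
  by (simp only: vec.scale_right_diff_distrib[symmetric] vec.span_scale)

global_interpretation NS: vector_space nscale
proof
  fix a b :: rat and x y :: NS
  show "a *N (x + y) = a *N x + a *N y"
    by transfer (simp only: vec.scale_right_distrib diff_self vec.span_zero)
  show "(a + b) *N x = a *N x + b *N x"
    by transfer (simp only: vec.scale_left_distrib diff_self vec.span_zero)
  show "a *N b *N x = (a * b) *N x"
    by transfer (simp only: vec.scale_scale diff_self vec.span_zero)
  show "1 *N x = x"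
    by transfer (simp only: vec.scale_one diff_self vec.span_zero)
qed


section \<open>F-curves\<close>

text \<open>
  Two boundary divisors intersect, or are equal, iff one of the two parts of the first is contained in
  one of the two parts of the second.
\<close>

definition meets :: "boundary \<Rightarrow> boundary \<Rightarrow> bool" where
  "meets J K \<longleftrightarrow> (\<exists>A\<in>sides J. \<exists>B\<in>sides K. A \<subseteq> B)"

text \<open>
  The irreducible components of the locus of curves with at least three nodes are the intersections
  of three distinct, pairwise intersecting boundary divisors.
\<close>

definition one_dim_stratum :: "boundary set \<Rightarrow> bool" where
  "one_dim_stratum \<sigma> \<longleftrightarrow> card \<sigma> = 3 \<and> (\<forall>J\<in>\<sigma>. \<forall>K\<in>\<sigma>. meets J K)"

text \<open>
  A numerical class of curves is the linear functional on the Neron-Severi space that it defines.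
  The boundary has simple normal crossings, and any number of pairwise intersecting boundary divisors
  have a nonempty irreducible intersection. So a boundary divisor that does not contain a given
  one-dimensional stratum intersects it transversally in a single point if it meets
  all the boundary divisors that cut out the stratum, and not at all otherwise. By linear equivalence,
  this determines the intersection numbers with the three boundary divisors that contain the stratum;
  see \<open>ex1_curve_class\<close> and \<open>F_curves_eq\<close> below.
\<close>

definition curve_class :: "boundary set \<Rightarrow> (NS \<Rightarrow> rat) \<Rightarrow> bool" where
  "curve_class \<sigma> \<phi> \<longleftrightarrow> Vector_Spaces.linear nscale (*) \<phi> \<and>
    (\<forall>J. J \<notin> \<sigma> \<longrightarrow> \<phi> (cls (axis J 1)) = (if \<forall>K\<in>\<sigma>. meets J K then 1 else 0))"

definition F_curves :: "(NS \<Rightarrow> rat) set" where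
  "F_curves = {\<phi>. \<exists>\<sigma>. one_dim_stratum \<sigma> \<and> curve_class \<sigma> \<phi>}"

definition F_nef :: "NS \<Rightarrow> bool" where
  "F_nef d \<longleftrightarrow> (\<forall>\<phi>\<in>F_curves. 0 \<le> \<phi> d)"


section \<open>The divisors of the theorem\<close>

text \<open>
  For a set \<open>I\<close> with four elements, the divisor does not depend on their order; see
  \<open>keel_divisor_eq\<close> below.
\<close>

definition keel_divisor :: "7 set \<Rightarrow> divisor" where
  "keel_divisor I = (THE D. \<exists>i j k l. I = {i, j, k, l} \<and>
    D = (1 / 3) *s (separating {i, j} {k, l} + separating {i, k} {j, l} + separating {i, l} {j, k}))"

definition B2 :: divisor where
  "B2 = (\<Sum>J | card J = 2. Delta J)"

definition B3 :: divisor where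
  "B3 = (\<Sum>J | card J = 3. Delta J)"

definition Dpt :: "7 \<Rightarrow> divisor" where
  "Dpt i = (\<Sum>j\<in>- {i}. Delta {i, j})"

definition Pdiv :: "rat \<Rightarrow> rat \<Rightarrow> rat \<Rightarrow> 7 \<Rightarrow> divisor" where
  "Pdiv \<alpha> lam \<mu> i = \<alpha> *s Dpt i + lam *s B2 + \<mu> *s B3"


section \<open>Consistency of the definitions\<close>

subsection \<open>The divisor \<open>keel_divisor I\<close> is well defined\<close>

lemma card_compl7: "card (- T) = 7 - card (T :: 7 set)"
  using card_Diff_subset[of T UNIV] by (simp flip: Compl_eq_Diff_UNIV)

lemma sides_bd:
  assumes "2 \<le> card T" "2 \<le> card (- T)"
  shows "sides (bd T) = {T, - T}"
  unfolding bd_def using assms by (intro Abs_boundary_inverse) blast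

lemma boundary_cases:
  obtains T where "J = bd T" "2 \<le> card T" "2 \<le> card (- T)" "sides J = {T, - T}"
proof -
  obtain T where T: "sides J = {T, - T}" "2 \<le> card T" "2 \<le> card (- T)"
    using sides[of J] by blast
  then have "J = bd T"
    by (metis bd_def sides_inverse)
  with T that show thesis by blast
qed

lemma bd_compl: "bd (- T) = bd T"
  by (simp add: bd_def insert_commute)

lemma bd_eq_iff:
  assumes "2 \<le> card S" "2 \<le> card (- S)" "2 \<le> card T" "2 \<le> card (- T)"
  shows "bd S = bd T \<longleftrightarrow> S = T \<or> S = - T"
  using sides_bd[OF assms(1,2)] sides_bd[OF assms(3,4)] bd_compl[of T]
  by (metis doubleton_eq_iff)

lemma in_sides_bd: "A \<in> sides J \<Longrightarrow> bd A = J \<and> 2 \<le> card A \<and> 2 \<le> card (- A)"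
  by (rule boundary_cases[of J]) (auto simp: bd_compl)

lemma meets_bd:
  assumes "2 \<le> card S" "2 \<le> card (- S)" "2 \<le> card T" "2 \<le> card (- T)"
  shows "meets (bd S) (bd T) \<longleftrightarrow> S \<subseteq> T \<or> S \<subseteq> - T \<or> - S \<subseteq> T \<or> - S \<subseteq> - T"
  unfolding meets_def sides_bd[OF assms(1,2)] sides_bd[OF assms(3,4)] by auto

lemma meets_sides:
  assumes "meets J K" "A \<in> sides J" "B \<in> sides K"
  shows "A \<subseteq> B \<or> B \<subseteq> A \<or> A \<inter> B = {} \<or> A \<union> B = UNIV"
proof -
  have "meets (bd A) (bd B)"
    using assms in_sides_bd by metis
  then show ?thesis
    using meets_bd[of A B] in_sides_bd[OF assms(2)] in_sides_bd[OF assms(3)] by blast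
qed

lemma separating_commute: "separating A B = separating B A"
  unfolding separating_def
  by (rule sum.reindex_bij_witness[of _ uminus uminus]) (auto simp: Delta_def bd_compl)

lemma card4_iff: "card {i, j, k, l} = 4 \<longleftrightarrow> distinct [i, j, k, l]"
  by (simp add: card_insert_if)

lemma keel_divisor_symmetric:
  assumes "card {i, j, k, l} = 4" "I = {i, j, k, l}"
  shows "separating {i, j} {k, l} + separating {i, k} {j, l} + separating {i, l} {j, k} =
    (1 / 2) *s (\<Sum>A | A \<subseteq> I \<and> card A = 2. separating A (I - A))"
proof -
  have d: "i \<noteq> j" "i \<noteq> k" "i \<noteq> l" "j \<noteq> k" "j \<noteq> l" "k \<noteq> l"
    using assms(1) by (simp_all add: card4_iff)
  have A: "{A. A \<subseteq> I \<and> card A = 2} = {{i, j}, {k, l}, {i, k}, {j, l}, {i, l}, {j, k}}"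
  proof (intro equalityI subsetI)
    fix A assume "A \<in> {A. A \<subseteq> I \<and> card A = 2}"
    then obtain x y where "A = {x, y}" "x \<noteq> y" "x \<in> I" "y \<in> I"
      by (auto simp: card_2_iff)
    then show "A \<in> {{i, j}, {k, l}, {i, k}, {j, l}, {i, l}, {j, k}}"
      unfolding assms(2) by (elim insertE) (simp_all add: insert_commute)
  next
    fix A assume "A \<in> {{i, j}, {k, l}, {i, k}, {j, l}, {i, l}, {j, k}}"
    then show "A \<in> {A. A \<subseteq> I \<and> card A = 2}"
      unfolding assms(2) using d by (elim insertE) auto
  qed
  have c: "I - {i, j} = {k, l}" "I - {k, l} = {i, j}" "I - {i, k} = {j, l}" "I - {j, l} = {i, k}"
    "I - {i, l} = {j, k}" "I - {j, k} = {i, l}"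
    using d unfolding assms(2) by auto
  have "(\<Sum>A | A \<subseteq> I \<and> card A = 2. separating A (I - A)) =
      separating {i, j} {k, l} + (separating {k, l} {i, j} + (separating {i, k} {j, l} +
      (separating {j, l} {i, k} + (separating {i, l} {j, k} + separating {j, k} {i, l}))))"
    unfolding A using d d[symmetric] by (simp add: doubleton_eq_iff c)
  also have "\<dots> = 2 *s (separating {i, j} {k, l} + separating {i, k} {j, l} + separating {i, l} {j, k})"
    by (simp add: separating_commute[of "{k, l}"] separating_commute[of "{j, l}"]
        separating_commute[of "{j, k}"] vec_eq_iff)
  finally show ?thesis
    by simp
qed

theorem keel_divisor_eq:
  assumes "card {i, j, k, l} = 4"
  shows "keel_divisor {i, j, k, l} =
    (1 / 3) *s (separating {i, j} {k, l} + separating {i, k} {j, l} + separating {i, l} {j, k})"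
  unfolding keel_divisor_def
proof (rule the_equality)
  fix D
  assume "\<exists>i' j' k' l'. {i, j, k, l} = {i', j', k', l'} \<and> D =
    (1 / 3) *s (separating {i', j'} {k', l'} + separating {i', k'} {j', l'} + separating {i', l'} {j', k'})"
  then show "D = (1 / 3) *s (separating {i, j} {k, l} + separating {i, k} {j, l} + separating {i, l} {j, k})"
    using assms keel_divisor_symmetric[OF _ refl] by (elim exE conjE) simp
qed blast


subsection \<open>The intersection number with the curves attached to a partition\<close>

text \<open>
  Every one-dimensional stratum has a single component with four special points, and the branches at
  these points partition the marked points. \<open>branch_number P J\<close> is the intersection number of the
  corresponding curve with the boundary divisor \<open>J\<close>.
\<close>

definition four_parts :: "7 set set \<Rightarrow> bool" where
  "four_parts P \<longleftrightarrow> partition_on UNIV P \<and> card P = 4"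

definition branch_number :: "7 set set \<Rightarrow> boundary \<Rightarrow> rat" where
  "branch_number P J =
    (if \<exists>A\<in>P. A \<in> sides J then - 1 else if \<exists>A\<in>P. \<exists>B\<in>P. A \<union> B \<in> sides J then 1 else 0)"

definition pairing :: "7 set set \<Rightarrow> divisor \<Rightarrow> rat" where
  "pairing P D = (\<Sum>J\<in>UNIV. D $ J * branch_number P J)"

definition F_number :: "7 set set \<Rightarrow> NS \<Rightarrow> rat" where
  "F_number P d = pairing P (rep_NS d)"

lemma four_partsD:
  assumes "four_parts P"
  shows "card P = 4" "finite P" "\<Union>P = UNIV" "{} \<notin> P"
    "\<And>A B x. A \<in> P \<Longrightarrow> B \<in> P \<Longrightarrow> x \<in> A \<Longrightarrow> x \<in> B \<Longrightarrow> A = B"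
  using assms by (auto simp: four_parts_def partition_on_def disjoint_def)

lemma Union_parts_inj:
  assumes "four_parts P" "Q \<subseteq> P" "Q' \<subseteq> P" "\<Union>Q = \<Union>Q'"
  shows "Q = Q'"
proof -
  have sub: "R \<subseteq> R'" if R: "R \<subseteq> P" "R' \<subseteq> P" "\<Union>R = \<Union>R'" for R R'
  proof
    fix A assume A: "A \<in> R"
    then have "A \<noteq> {}"
      using R four_partsD(4)[OF assms(1)] by blast
    then obtain x where x: "x \<in> A"
      by blast
    then obtain B where "B \<in> R'" "x \<in> B"
      using A R by blast
    then show "A \<in> R'"
      using four_partsD(5)[OF assms(1), of A B x] A x R by blast
  qed
  show ?thesis
    using sub[OF assms(2,3,4)] sub[OF assms(3,2) assms(4)[symmetric]] by (rule equalityI)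
qed

lemma part_exists:
  assumes "four_parts P"
  obtains A where "A \<in> P" "x \<in> A"
proof -
  have "x \<in> \<Union>P"
    by (simp add: four_partsD(3)[OF assms])
  with that show thesis by blast
qed

lemma in_Union_parts:
  assumes "four_parts P" "Q \<subseteq> P" "A \<in> P" "x \<in> A"
  shows "x \<in> \<Union>Q \<longleftrightarrow> A \<in> Q"
  using four_partsD(5)[OF assms(1) assms(3) _ assms(4)] assms(2,4) by (metis UnionE UnionI subsetD)

lemma compl_Union_parts:
  assumes "four_parts P" "Q \<subseteq> P"
  shows "- \<Union>Q = \<Union>(P - Q)"
proof (rule set_eqI)
  fix x
  obtain A where "A \<in> P" "x \<in> A"
    using part_exists[OF assms(1)] .
  then show "x \<in> - \<Union>Q \<longleftrightarrow> x \<in> \<Union>(P - Q)"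
    using in_Union_parts[OF assms(1)] assms(2) by (metis Compl_iff Diff_iff Diff_subset)
qed

lemma branch_number_Union:
  assumes P: "four_parts P" and Q: "Q \<subseteq> P" and c: "2 \<le> card (\<Union>Q)" "2 \<le> card (- \<Union>Q)"
  shows "branch_number P (bd (\<Union>Q)) = (- 1) ^ card Q"
proof -
  note s = sides_bd[OF c] compl_Union_parts[OF P Q]
  have fQ: "finite Q"
    by simp
  have cQ: "card Q + card (P - Q) = 4"
    using card_mono[OF four_partsD(2)[OF P] Q] card_Diff_subset[OF fQ Q] four_partsD(1)[OF P] by simp
  have ne: "Q \<noteq> {}" "P - Q \<noteq> {}"
  proof -
    show "Q \<noteq> {}"
      using c by auto
    show "P - Q \<noteq> {}"
    proof
      assume "P - Q = {}"
      then have "- \<Union>Q = {}"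
        by (simp only: compl_Union_parts[OF P Q] Union_empty)
      with c show False by simp
    qed
  qed
  have inj: "R = R'" if "\<Union>R = \<Union>R'" "R \<subseteq> P" "R' \<subseteq> P" for R R'
    using Union_parts_inj[OF P] that by blast
  have sides: "sides (bd (\<Union>Q)) = {\<Union>Q, \<Union>(P - Q)}"
    by (simp only: s)
  have mem: "\<Union>R \<in> sides (bd (\<Union>Q)) \<longleftrightarrow> Q = R \<or> P - Q = R" if "R \<subseteq> P" for R
    using inj[OF _ Q that] inj[OF _ Diff_subset that] unfolding sides by (metis insertCI insertE singletonD)
  have one: "A \<in> sides (bd (\<Union>Q)) \<longleftrightarrow> Q = {A} \<or> P - Q = {A}" if "A \<in> P" for A
    using mem[of "{A}"] that by (simp del: Diff_insert0)
  have two: "A \<union> B \<in> sides (bd (\<Union>Q)) \<longleftrightarrow> Q = {A, B} \<or> P - Q = {A, B}"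
    if "A \<in> P" "B \<in> P" for A B
    using mem[of "{A, B}"] that by simp
  consider "card Q = 1" | "card (P - Q) = 1" "card Q = 3" | "card Q = 2" "card (P - Q) = 2"
  proof -
    have "card Q \<noteq> 0" "card (P - Q) \<noteq> 0"
      using ne by (auto simp: card_eq_0_iff)
    with cQ that show thesis by linarith
  qed
  then show ?thesis
  proof cases
    case 1
    then obtain A where "Q = {A}"
      by (auto simp: card_1_singleton_iff)
    then have "\<exists>A\<in>P. A \<in> sides (bd (\<Union>Q))"
      using one Q by blast
    with 1 show ?thesis by (simp add: branch_number_def)
  next
    case 2
    then obtain A where "P - Q = {A}"
      by (auto simp: card_1_singleton_iff)
    then have "\<exists>A\<in>P. A \<in> sides (bd (\<Union>Q))"
      using one by blast
    with 2 show ?thesis by (simp add: branch_number_def)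
  next
    case 3
    then obtain A B where "Q = {A, B}"
      by (auto simp: card_2_iff)
    moreover from this have "A \<in> P" "B \<in> P"
      using Q by simp_all
    ultimately have "\<exists>A\<in>P. \<exists>B\<in>P. A \<union> B \<in> sides (bd (\<Union>Q))"
      using two by metis
    moreover have "A \<notin> sides (bd (\<Union>Q))" if "A \<in> P" for A
    proof
      assume "A \<in> sides (bd (\<Union>Q))"
      then have "Q = {A} \<or> P - Q = {A}"
        using one[OF that] by blast
      with 3 show False by auto
    qed
    ultimately show ?thesis using 3 by (simp add: branch_number_def)
  qed
qed

lemma branch_number_other:
  assumes P: "four_parts P" and c: "2 \<le> card T" "2 \<le> card (- T)" and T: "\<And>Q. Q \<subseteq> P \<Longrightarrow> T \<noteq> \<Union>Q"
  shows "branch_number P (bd T) = 0"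
proof -
  have "\<Union>Q \<noteq> - T" if "Q \<subseteq> P" for Q
    using compl_Union_parts[OF P that] T[of "P - Q"] by (metis Diff_subset double_complement)
  then have n: "\<Union>Q \<notin> sides (bd T)" if "Q \<subseteq> P" for Q
    using that T by (auto simp: sides_bd[OF c])
  have "A \<notin> sides (bd T)" if "A \<in> P" for A
    using n[of "{A}"] that by simp
  moreover have "A \<union> B \<notin> sides (bd T)" if "A \<in> P" "B \<in> P" for A B
    using n[of "{A, B}"] that by simp
  ultimately show ?thesis
    by (simp add: branch_number_def)
qed

lemma alternating_sum_interval:
  assumes "finite P" "R \<subseteq> P" "S \<subseteq> P"
  shows "(\<Sum>Q | R \<subseteq> Q \<and> Q \<subseteq> P - S. (- 1) ^ card Q :: rat) =
    (if R \<union> S = P \<and> R \<inter> S = {} then (- 1) ^ card R else 0)"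
proof (cases "R \<union> S = P \<and> R \<inter> S = {}")
  case True
  then have "{Q. R \<subseteq> Q \<and> Q \<subseteq> P - S} = {R}"
    by blast
  with True show ?thesis by simp
next
  case False
  have "(\<Sum>Q | R \<subseteq> Q \<and> Q \<subseteq> P - S. (- 1) ^ card Q :: rat) = 0"
  proof (cases "R \<inter> S = {}")
    case False
    then have "{Q. R \<subseteq> Q \<and> Q \<subseteq> P - S} = {}"
      by blast
    then show ?thesis by (simp only: sum.empty)
  next
    case True
    with False obtain y where y: "y \<in> P" "y \<notin> R" "y \<notin> S"
      using assms by blast
    define X where "X = {Q. R \<subseteq> Q \<and> Q \<subseteq> P - S \<and> y \<notin> Q}"
    have fin: "finite X"
      unfolding X_def using assms(1) by (auto intro: finite_subset[of _ "Pow P"])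
    have X: "{Q. R \<subseteq> Q \<and> Q \<subseteq> P - S} = X \<union> insert y ` X"
    proof (intro equalityI subsetI)
      fix Q assume Q: "Q \<in> {Q. R \<subseteq> Q \<and> Q \<subseteq> P - S}"
      show "Q \<in> X \<union> insert y ` X"
      proof (cases "y \<in> Q")
        case True
        then have "Q = insert y (Q - {y})" "Q - {y} \<in> X"
          using Q y by (auto simp: X_def)
        then show ?thesis by blast
      qed (use Q in \<open>auto simp: X_def\<close>)
    qed (use y in \<open>auto simp: X_def\<close>)
    have "inj_on (insert y) X"
      by (auto simp: inj_on_def X_def)
    moreover have "X \<inter> insert y ` X = {}"
      by (auto simp: X_def)
    moreover have "card (insert y Q) = Suc (card Q)" if "Q \<in> X" for Q
      using that assms(1) by (auto simp: X_def intro!: card_insert_disjoint intro: finite_subset)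
    ultimately show ?thesis
      unfolding X using fin by (simp add: sum.union_disjoint sum.reindex sum_negf)
  qed
  with False show ?thesis by (simp only: if_False)
qed

lemma pairing_add: "pairing P (D + E) = pairing P D + pairing P E"
  by (simp add: pairing_def algebra_simps sum.distrib)

lemma pairing_scale: "pairing P (c *s D) = c * pairing P D"
  by (simp add: pairing_def algebra_simps sum_distrib_left)

lemma pairing_diff: "pairing P (D - E) = pairing P D - pairing P E"
  by (simp add: pairing_def algebra_simps sum_subtractf)

lemma pairing_sum: "pairing P (\<Sum>x\<in>X. f x) = (\<Sum>x\<in>X. pairing P (f x))"
proof (induction X rule: infinite_finite_induct)
  case (insert x F)
  then show ?case by (simp add: pairing_add)
qed (simp_all add: pairing_def)

lemma pairing_axis: "pairing P (axis J 1) = branch_number P J"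
proof -
  have "pairing P (axis J 1) = (\<Sum>K\<in>UNIV. if K = J then branch_number P J else 0)"
    unfolding pairing_def by (rule sum.cong) (auto simp: axis_def)
  then show ?thesis by simp
qed

lemma pairing_separating:
  assumes P: "four_parts P" and d: "card {i, j, k, l} = 4"
  shows "pairing P (separating {i, j} {k, l}) = (if \<forall>A\<in>P. A \<inter> {i, j, k, l} \<noteq> {} then 1 else 0)"
proof -
  define R where "R = {A \<in> P. A \<inter> {i, j} \<noteq> {}}"
  define S where "S = {A \<in> P. A \<inter> {k, l} \<noteq> {}}"
  define Ts where "Ts = {T. 2 \<le> card T \<and> 2 \<le> card (- T) \<and> {i, j} \<subseteq> T \<and> {k, l} \<subseteq> - T}"
  have d: "i \<noteq> j" "i \<noteq> k" "i \<noteq> l" "j \<noteq> k" "j \<noteq> l" "k \<noteq> l"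
    using d by (simp_all add: card4_iff)
  have iff: "{i, j} \<subseteq> \<Union>Q \<and> {k, l} \<subseteq> - \<Union>Q \<longleftrightarrow> R \<subseteq> Q \<and> Q \<subseteq> P - S" if Q: "Q \<subseteq> P" for Q
  proof -
    have m: "x \<in> \<Union>Q \<longleftrightarrow> (\<forall>A\<in>P. x \<in> A \<longrightarrow> A \<in> Q)" for x
      using in_Union_parts[OF P Q] part_exists[OF P, of x] by metis
    have n: "x \<in> - \<Union>Q \<longleftrightarrow> (\<forall>A\<in>P. x \<in> A \<longrightarrow> A \<notin> Q)" for x
      using Q by blast
    show ?thesis
      unfolding R_def S_def insert_subset m n using Q by auto
  qed
  have card: "2 \<le> card T \<and> 2 \<le> card (- T)" if "{i, j} \<subseteq> T" "{k, l} \<subseteq> - T" for T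
    using card_mono[OF _ that(1)] card_mono[OF _ that(2)] d by simp
  have im: "Union ` {Q. R \<subseteq> Q \<and> Q \<subseteq> P - S} \<subseteq> Ts"
  proof
    fix T assume "T \<in> Union ` {Q. R \<subseteq> Q \<and> Q \<subseteq> P - S}"
    then obtain Q where Q: "T = \<Union>Q" "R \<subseteq> Q" "Q \<subseteq> P - S"
      by blast
    have "Q \<subseteq> P"
      using Q(3) by (rule order.trans) (rule Diff_subset)
    then have "{i, j} \<subseteq> T \<and> {k, l} \<subseteq> - T"
      unfolding Q(1) using iff Q(2,3) by metis
    then show "T \<in> Ts"
      using card by (simp add: Ts_def)
  qed
  have "pairing P (separating {i, j} {k, l}) = (\<Sum>T\<in>Ts. branch_number P (bd T))"
    by (simp add: separating_def pairing_sum Delta_def pairing_axis Ts_def)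
  also have "\<dots> = (\<Sum>T\<in>Union ` {Q. R \<subseteq> Q \<and> Q \<subseteq> P - S}. branch_number P (bd T))"
  proof (rule sum.mono_neutral_right[OF _ im])
    show "\<forall>T\<in>Ts - Union ` {Q. R \<subseteq> Q \<and> Q \<subseteq> P - S}. branch_number P (bd T) = 0"
    proof
      fix T assume T: "T \<in> Ts - Union ` {Q. R \<subseteq> Q \<and> Q \<subseteq> P - S}"
      have "T \<noteq> \<Union>Q" if Q: "Q \<subseteq> P" for Q
      proof
        assume e: "T = \<Union>Q"
        have "R \<subseteq> Q \<and> Q \<subseteq> P - S"
          using T unfolding Ts_def e by (subst iff[OF Q, symmetric]) simp
        with T e show False by simp
      qed
      then show "branch_number P (bd T) = 0"
        using T by (intro branch_number_other[OF P]) (auto simp: Ts_def)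
    qed
  qed simp
  also have "\<dots> = (\<Sum>Q | R \<subseteq> Q \<and> Q \<subseteq> P - S. branch_number P (bd (\<Union>Q)))"
  proof (rule sum.reindex_cong[where l = Union])
    show "inj_on Union {Q. R \<subseteq> Q \<and> Q \<subseteq> P - S}"
    proof (rule inj_onI)
      fix Q Q' assume "Q \<in> {Q. R \<subseteq> Q \<and> Q \<subseteq> P - S}" "Q' \<in> {Q. R \<subseteq> Q \<and> Q \<subseteq> P - S}"
      then have "Q \<subseteq> P" "Q' \<subseteq> P"
        by blast+
      then show "\<Union>Q = \<Union>Q' \<Longrightarrow> Q = Q'"
        by (rule Union_parts_inj[OF P])
    qed
  qed simp_all
  also have "\<dots> = (\<Sum>Q | R \<subseteq> Q \<and> Q \<subseteq> P - S. (- 1) ^ card Q)"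
  proof (rule sum.cong)
    fix Q assume "Q \<in> {Q. R \<subseteq> Q \<and> Q \<subseteq> P - S}"
    moreover from this have "Q \<subseteq> P"
      by blast
    moreover have "\<Union>Q \<in> Ts"
      using im calculation(1) by (meson image_eqI subsetD)
    ultimately show "branch_number P (bd (\<Union>Q)) = (- 1) ^ card Q"
      by (intro branch_number_Union[OF P]) (auto simp: Ts_def)
  qed simp
  also have "\<dots> = (if R \<union> S = P \<and> R \<inter> S = {} then (- 1) ^ card R else 0)"
    by (rule alternating_sum_interval) (auto simp: R_def S_def)
  also have "\<dots> = (if R \<union> S = P then 1 else 0)"
  proof -
    have "\<forall>x. \<exists>A. A \<in> P \<and> x \<in> A"
      using part_exists[OF P] by metis
    then obtain p where p: "\<And>x. p x \<in> P" "\<And>x. x \<in> p x"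
      by metis
    have pu: "A = p x" if "A \<in> P" "x \<in> A" for A x
      using four_partsD(5)[OF P that(1) p(1) that(2) p(2)] .
    have "R = p ` {i, j}" "S = p ` {k, l}"
      unfolding R_def S_def using p pu by auto
    then have le: "card R \<le> 2" "card S \<le> 2"
      using card_image_le[of "{i, j}" p] card_image_le[of "{k, l}" p] d by simp_all
    have "card R = 2 \<and> R \<inter> S = {}" if "R \<union> S = P"
    proof -
      have "card R + card S = 4 + card (R \<inter> S)"
        using card_Un_Int[of R S] that four_partsD(1)[OF P] by simp
      with le have "card R = 2" "card (R \<inter> S) = 0"
        by linarith+
      then show ?thesis by (simp add: card_eq_0_iff)
    qed
    then show ?thesis by simp
  qed
  also have "R \<union> S = P \<longleftrightarrow> (\<forall>A\<in>P. A \<inter> {i, j, k, l} \<noteq> {})"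
  proof -
    have "R \<union> S = {A \<in> P. A \<inter> {i, j, k, l} \<noteq> {}}"
      unfolding R_def S_def by (rule set_eqI) (auto split: if_splits)
    also have "\<dots> = P \<longleftrightarrow> (\<forall>A\<in>P. A \<inter> {i, j, k, l} \<noteq> {})"
      by (simp only: set_eq_iff mem_Collect_eq) (simp only: Ball_def, metis)
    finally show ?thesis .
  qed
  finally show ?thesis .
qed

lemma pairing_keel_relations:
  assumes "four_parts P" "D \<in> vec.span keel_relations"
  shows "pairing P D = 0"
  using assms(2)
proof (induction rule: vec.span_induct_alt)
  case base
  then show ?case by (simp add: pairing_def)
next
  case (step c x y)
  then obtain i j k l where x: "x = separating {i, j} {k, l} - separating {i, k} {j, l}"
      "card {i, j, k, l} = 4"
    unfolding keel_relations_def by blast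
  have "pairing P x = 0"
    using pairing_separating[OF assms(1), of i j k l] pairing_separating[OF assms(1), of i k j l] x
    by (simp add: pairing_diff insert_commute)
  with step show ?case
    by (simp add: pairing_add pairing_scale)
qed

lemma cls_eq_iff: "cls D = cls E \<longleftrightarrow> D - E \<in> vec.span keel_relations"
  by (simp add: NS.abs_eq_iff)

lemma F_number_cls:
  assumes "four_parts P"
  shows "F_number P (cls D) = pairing P D"
proof -
  have "cls (rep_NS (cls D)) = cls D"
    using Quotient3_abs_rep[OF Quotient3_NS] by blast
  then have "pairing P (rep_NS (cls D) - D) = 0"
    using pairing_keel_relations[OF assms] cls_eq_iff by blast
  then show ?thesis
    by (simp add: F_number_def pairing_diff)
qed

lemma cls_surj: obtains D where "d = cls D"
  using Quotient3_abs_rep[OF Quotient3_NS] by metis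

lemma linear_F_number:
  assumes "four_parts P"
  shows "Vector_Spaces.linear nscale (*) (F_number P)"
proof (unfold_locales)
  show "F_number P (d + e) = F_number P d + F_number P e" for d e
    by (rule cls_surj[of d], rule cls_surj[of e])
      (simp add: F_number_cls[OF assms] pairing_add plus_NS.abs_eq)
  show "F_number P (c *N d) = c * F_number P d" for c d
    by (rule cls_surj[of d]) (simp add: F_number_cls[OF assms] pairing_scale nscale.abs_eq)
qed


subsection \<open>Every one-dimensional stratum determines a unique class of curves\<close>

text \<open>
  \<open>branches \<sigma> P\<close>: the parts of \<open>P\<close> are the sets of marked points on the four branches of the
  stratum \<open>\<sigma>\<close>.
\<close>

definition branches :: "boundary set \<Rightarrow> 7 set set \<Rightarrow> bool" where
  "branches \<sigma> P \<longleftrightarrow> four_parts P \<and> (\<forall>A\<in>P. 2 \<le> card A \<longrightarrow> bd A \<in> \<sigma>) \<and>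
    (\<forall>J\<in>\<sigma>. \<exists>A\<in>sides J. \<exists>B\<in>P. A \<subseteq> B)"

lemma laminar_bound:
  assumes "finite X" "X \<noteq> {}" "\<And>A. A \<in> L \<Longrightarrow> A \<subseteq> X \<and> 2 \<le> card A"
    and "\<And>A B. A \<in> L \<Longrightarrow> B \<in> L \<Longrightarrow> A \<subseteq> B \<or> B \<subseteq> A \<or> A \<inter> B = {}"
  shows "card L + 1 \<le> card X"
  using assms
proof (induction "card X" arbitrary: X L rule: less_induct)
  case less
  note X = less.prems
  have finL: "finite L"
    using X(1,3) by (intro finite_subset[of L "Pow X"]) auto
  have posX: "1 \<le> card X"
    using X(1,2) by (simp add: Suc_le_eq card_gt_0_iff)
  show ?case
  proof (cases "L - {X} = {}")
    case True
    then have "L = {} \<or> L = {X}"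
      by blast
    then show ?thesis
      using posX X(3)[of X] by auto
  next
    case False
    then obtain M where M: "M \<in> L - {X}" "\<And>B. B \<in> L - {X} \<Longrightarrow> M \<subseteq> B \<Longrightarrow> M = B"
      using finite_has_maximal[of "L - {X}"] finL by auto
    have MX: "M \<subset> X" "2 \<le> card M"
      using M(1) X(3) by auto
    define L1 L2 where "L1 = {A \<in> L - {X}. A \<subseteq> M}" and "L2 = {A \<in> L - {X}. A \<inter> M = {}}"
    have L: "L - {X} = L1 \<union> L2"
    proof (intro equalityI subsetI)
      fix A assume A: "A \<in> L - {X}"
      then have "A \<subseteq> M \<or> M \<subseteq> A \<or> A \<inter> M = {}"
        using X(4)[of A M] M(1) by blast
      then show "A \<in> L1 \<union> L2"
        using A M(2)[OF A] by (auto simp: L1_def L2_def)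
    qed (auto simp: L1_def L2_def)
    have finM: "finite M"
      using MX(1) X(1) finite_subset by blast
    have split: "card M + card (X - M) = card X"
      using MX(1) finM X(1) by (simp add: card_Diff_subset card_mono less_imp_le)
    have "card L1 + 1 \<le> card M"
      using X(3,4) MX psubset_card_mono[OF X(1) MX(1)] finM
      by (intro less.hyps) (auto simp: L1_def)
    moreover have "card L2 + 1 \<le> card (X - M)"
    proof (rule less.hyps)
      show "card (X - M) < card X"
        using split MX(2) by linarith
      show "A \<subseteq> X - M \<and> 2 \<le> card A" if "A \<in> L2" for A
        using that X(3)[of A] by (auto simp: L2_def)
      show "A \<subseteq> B \<or> B \<subseteq> A \<or> A \<inter> B = {}" if "A \<in> L2" "B \<in> L2" for A B
        using that X(4)[of A B] by (auto simp: L2_def)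
    qed (use X(1) MX(1) in auto)
    moreover note split
    moreover have "card L \<le> card (L - {X}) + 1"
      using finL by (cases "X \<in> L") (simp_all add: card_Diff_singleton_if)
    moreover have "card (L - {X}) \<le> card L1 + card L2"
      unfolding L by (rule card_Un_le)
    ultimately show ?thesis
      by linarith
  qed
qed

lemma chain_exists:
  assumes "finite X" "X \<noteq> {}"
  shows "\<exists>L. (\<forall>A\<in>L. A \<subseteq> X \<and> 2 \<le> card A) \<and> (\<forall>A\<in>L. \<forall>B\<in>L. A \<subseteq> B \<or> B \<subseteq> A) \<and>
    card L + 1 = card X \<and> (2 \<le> card X \<longrightarrow> X \<in> L)"
  using assms
proof (induction X rule: finite_ne_induct)
  case (singleton x)
  show ?case by (intro exI[of _ "{}"]) simp
next
  case (insert x F)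
  obtain L where L: "\<forall>A\<in>L. A \<subseteq> F \<and> 2 \<le> card A" "\<forall>A\<in>L. \<forall>B\<in>L. A \<subseteq> B \<or> B \<subseteq> A"
      "card L + 1 = card F"
    using insert.IH by (elim exE conjE)
  have finL: "finite L"
    using L(1) insert.hyps(1) by (intro finite_subset[of L "Pow F"]) auto
  have notin: "insert x F \<notin> L"
    using L(1) insert.hyps by blast
  have card: "card (insert x F) = card F + 1" "1 \<le> card F"
    using insert.hyps by (simp_all add: Suc_le_eq card_gt_0_iff)
  show ?case
  proof (intro exI[of _ "insert (insert x F) L"] conjI ballI impI)
    fix A assume A: "A \<in> insert (insert x F) L"
    show "A \<subseteq> insert x F" "2 \<le> card A"
      using A L(1) card by auto
    show "A \<subseteq> B \<or> B \<subseteq> A" if "B \<in> insert (insert x F) L" for B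
      using A that L(1,2) by blast
  next
    show "card (insert (insert x F) L) + 1 = card (insert x F)"
      using card(1) L(3) finL notin by simp
  qed simp
qed

lemma sum_card_parts:
  assumes "four_parts P"
  shows "(\<Sum>A\<in>P. card A) = 7"
proof -
  have "card (\<Union>P) = (\<Sum>A\<in>P. card A)"
    using assms by (intro card_Union_disjoint) (auto simp: four_parts_def partition_on_def)
  then show ?thesis
    by (simp add: four_partsD(3)[OF assms])
qed

lemma part_nonempty:
  assumes "four_parts P" "A \<in> P"
  shows "A \<noteq> {}" "1 \<le> card A"
proof -
  show "A \<noteq> {}"
    using four_partsD(4)[OF assms(1)] assms(2) by auto
  then show "1 \<le> card A"
    by (simp add: Suc_le_eq card_gt_0_iff)
qed

lemma card_compl_part:
  assumes "four_parts P" "A \<in> P"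
  shows "3 \<le> card (- A)"
proof -
  have "(\<Sum>B\<in>P - {A}. 1) \<le> (\<Sum>B\<in>P - {A}. card B)"
    using part_nonempty(2)[OF assms(1)] by (intro sum_mono) simp
  then have "3 \<le> (\<Sum>B\<in>P - {A}. card B)"
    using assms four_partsD(1)[OF assms(1)] by simp
  moreover have "(\<Sum>B\<in>P. card B) = card A + (\<Sum>B\<in>P - {A}. card B)"
    using assms(2) by (simp add: sum.remove)
  ultimately show ?thesis
    using sum_card_parts[OF assms(1)] by (simp add: card_compl7)
qed

lemma third_part:
  assumes "four_parts P" "A \<in> P" "B \<in> P"
  shows "A \<union> B \<noteq> UNIV"
proof
  assume u: "A \<union> B = UNIV"
  have "card {A, B} \<le> 2"
    by (simp add: card_insert_if)
  then have "P \<noteq> {A, B}"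
    using four_partsD(1)[OF assms(1)] by auto
  then obtain C where C: "C \<in> P" "C \<noteq> A" "C \<noteq> B"
    using assms(2,3) by blast
  then obtain x where "x \<in> C"
    using part_nonempty(1)[OF assms(1)] by blast
  then show False
    using u C four_partsD(5)[OF assms(1) C(1), of _ x] assms(2,3) by blast
qed

lemma card_compl_sub_part:
  assumes "four_parts P" "B \<in> P" "A \<subseteq> B"
  shows "2 \<le> card (- A)"
  using card_compl_part[OF assms(1,2)] card_mono[of "- A" "- B"] assms(3) by simp

lemma card_refining:
  assumes P: "four_parts P" and m: "\<And>J K. J \<in> \<tau> \<Longrightarrow> K \<in> \<tau> \<Longrightarrow> meets J K"
    and r: "\<And>J. J \<in> \<tau> \<Longrightarrow> \<exists>A\<in>sides J. \<exists>B\<in>P. A \<subseteq> B"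
  shows "card \<tau> \<le> 3"
proof -
  define L where "L = (\<lambda>X. {A. A \<subseteq> X \<and> 2 \<le> card A \<and> bd A \<in> \<tau>})"
  have lam: "card (L X) + 1 \<le> card X" if X: "X \<in> P" for X
  proof (rule laminar_bound)
    fix A B assume A: "A \<in> L X" "B \<in> L X"
    have c: "2 \<le> card A" "2 \<le> card (- A)" "2 \<le> card B" "2 \<le> card (- B)" "A \<subseteq> X" "B \<subseteq> X"
      using A card_compl_sub_part[OF P X] by (auto simp: L_def)
    have "meets (bd A) (bd B)"
      using A by (intro m) (auto simp: L_def)
    then have "A \<subseteq> B \<or> B \<subseteq> A \<or> A \<inter> B = {} \<or> A \<union> B = UNIV"
      using meets_bd[OF c(1-4)] by blast
    moreover have "A \<union> B \<noteq> UNIV"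
      using c third_part[OF P X X] by auto
    ultimately show "A \<subseteq> B \<or> B \<subseteq> A \<or> A \<inter> B = {}"
      by blast
  qed (use part_nonempty[OF P X] in \<open>auto simp: L_def\<close>)
  have "\<tau> \<subseteq> bd ` (\<Union>X\<in>P. L X)"
  proof
    fix J assume J: "J \<in> \<tau>"
    then obtain A B where A: "A \<in> sides J" "B \<in> P" "A \<subseteq> B"
      using r by blast
    then have "A \<in> L B" "bd A = J"
      using in_sides_bd[OF A(1)] J by (auto simp: L_def)
    with A(2) show "J \<in> bd ` (\<Union>X\<in>P. L X)"
      by blast
  qed
  then have "card \<tau> \<le> card (bd ` (\<Union>X\<in>P. L X))"
    by (intro card_mono) simp_all
  also have "\<dots> \<le> card (\<Union>X\<in>P. L X)"
    by (rule card_image_le) simp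
  also have "\<dots> \<le> (\<Sum>X\<in>P. card (L X))"
    by (rule card_UN_le) simp
  finally have "card \<tau> + 4 \<le> (\<Sum>X\<in>P. card (L X) + 1)"
    using four_partsD(1)[OF P] by (simp add: sum.distrib del: One_nat_def)
  also have "\<dots> \<le> (\<Sum>X\<in>P. card X)"
    using lam by (intro sum_mono)
  finally show ?thesis
    using sum_card_parts[OF P] by simp
qed

lemma meets_refl: "meets J J"
  by (rule boundary_cases[of J]) (auto simp: meets_def)

lemma meets_commute: "meets J K \<longleftrightarrow> meets K J"
proof -
  have "meets K J" if "meets J K" for J K
  proof (rule boundary_cases[of J], rule boundary_cases[of K])
    fix S T assume J: "J = bd S" "2 \<le> card S" "2 \<le> card (- S)" and K: "K = bd T" "2 \<le> card T" "2 \<le> card (- T)"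
    then have "S \<subseteq> T \<or> S \<subseteq> - T \<or> - S \<subseteq> T \<or> - S \<subseteq> - T"
      using that meets_bd[of S T] by simp
    then have "T \<subseteq> S \<or> T \<subseteq> - S \<or> - T \<subseteq> S \<or> - T \<subseteq> - S"
      by blast
    then show "meets K J"
      using J K meets_bd[of T S] by simp
  qed
  then show ?thesis by blast
qed

lemma branch_number_transversal:
  assumes \<sigma>: "one_dim_stratum \<sigma>" and P: "branches \<sigma> P" and J: "J \<notin> \<sigma>"
  shows "branch_number P J = (if \<forall>K\<in>\<sigma>. meets J K then 1 else 0)"
proof -
  have four: "four_parts P" and in\<sigma>: "\<And>A. A \<in> P \<Longrightarrow> 2 \<le> card A \<Longrightarrow> bd A \<in> \<sigma>"
    and ref: "\<And>K. K \<in> \<sigma> \<Longrightarrow> \<exists>A\<in>sides K. \<exists>B\<in>P. A \<subseteq> B"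
    using P by (auto simp: branches_def)
  have no_part: "A \<notin> sides J" if "A \<in> P" for A
    using in\<sigma>[OF that] in_sides_bd[of A J] J by blast
  show ?thesis
  proof (cases "\<exists>A\<in>P. \<exists>B\<in>P. A \<union> B \<in> sides J")
    case True
    then obtain A B where AB: "A \<in> P" "B \<in> P" "A \<union> B \<in> sides J"
      by blast
    have "meets J K" if K: "K \<in> \<sigma>" for K
    proof -
      obtain C X where C: "C \<in> sides K" "X \<in> P" "C \<subseteq> X"
        using ref[OF K] by blast
      have "X \<subseteq> A \<union> B \<or> X \<subseteq> - (A \<union> B)"
      proof (cases "X = A \<or> X = B")
        case False
        then have "x \<notin> A \<union> B" if "x \<in> X" for x
          using four_partsD(5)[OF four C(2) AB(1) that] four_partsD(5)[OF four C(2) AB(2) that] by blast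
        then show ?thesis by blast
      qed blast
      then have "C \<subseteq> A \<union> B \<or> C \<subseteq> - (A \<union> B)"
        using C(3) by blast
      moreover have "- (A \<union> B) \<in> sides J"
        using AB(3) by (rule_tac boundary_cases[of J]) auto
      ultimately have "meets K J"
        using AB(3) C(1) unfolding meets_def by blast
      then show ?thesis
        by (simp add: meets_commute)
    qed
    with True no_part show ?thesis
      unfolding branch_number_def by auto
  next
    case False
    have "\<not> (\<forall>K\<in>\<sigma>. meets J K)"
    proof
      assume all: "\<forall>K\<in>\<sigma>. meets J K"
      have notin: "\<not> A \<subseteq> B" if "A \<in> sides J" "B \<in> P" for A B
      proof
        assume "A \<subseteq> B"
        have "card (insert J \<sigma>) \<le> 3"
        proof (rule card_refining[OF four])
          show "meets K K'" if "K \<in> insert J \<sigma>" "K' \<in> insert J \<sigma>" for K K'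
            using that all \<sigma> meets_refl meets_commute unfolding one_dim_stratum_def by blast
          show "\<exists>A\<in>sides K. \<exists>B\<in>P. A \<subseteq> B" if "K \<in> insert J \<sigma>" for K
            using that ref \<open>A \<subseteq> B\<close> \<open>A \<in> sides J\<close> \<open>B \<in> P\<close> by blast
        qed
        then show False
          using J \<sigma> by (simp add: one_dim_stratum_def)
      qed
      obtain T where T: "J = bd T" "2 \<le> card T" "2 \<le> card (- T)" "sides J = {T, - T}"
        by (rule boundary_cases)
      have sub: "X \<subseteq> T \<or> X \<subseteq> - T" if X: "X \<in> P" for X
      proof (cases "2 \<le> card X")
        case True
        have "meets J (bd X)"
          using all in\<sigma>[OF X True] by blast
        moreover have "X \<in> sides (bd X)"
          using sides_bd[OF True] card_compl_part[OF four X] by simp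
        ultimately have "T \<subseteq> X \<or> X \<subseteq> T \<or> T \<inter> X = {} \<or> T \<union> X = UNIV"
          using meets_sides[of J "bd X" T X] T(4) by simp
        then show ?thesis
          using notin[of T X] notin[of "- T" X] X T(4) by blast
      next
        case False
        then have "card X = 1"
          using part_nonempty(2)[OF four X] by linarith
        then obtain x where "X = {x}"
          by (rule card_1_singletonE)
        then show ?thesis by blast
      qed
      define Q where "Q = {X \<in> P. X \<subseteq> T}"
      have QP: "Q \<subseteq> P"
        by (auto simp: Q_def)
      have TQ: "T = \<Union>Q"
      proof (intro equalityI subsetI)
        fix x assume x: "x \<in> T"
        obtain X where X: "X \<in> P" "x \<in> X"
          using part_exists[OF four] .
        then have "X \<subseteq> T"
          using sub[OF X(1)] x by blast
        with X show "x \<in> \<Union>Q"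
          by (auto simp: Q_def)
      qed (auto simp: Q_def)
      have "branch_number P J = (- 1) ^ card Q"
        using branch_number_Union[OF four QP] T by (simp flip: TQ)
      moreover have "branch_number P J = 0"
        using False no_part by (simp add: branch_number_def)
      ultimately show False by simp
    qed
    with False no_part show ?thesis
      by (auto simp: branch_number_def)
  qed
qed

lemma stratum_of_partition:
  assumes P: "four_parts P"
  shows "\<exists>\<sigma>. one_dim_stratum \<sigma> \<and> branches \<sigma> P"
proof -
  have "\<forall>X\<in>P. \<exists>L. (\<forall>A\<in>L. A \<subseteq> X \<and> 2 \<le> card A) \<and> (\<forall>A\<in>L. \<forall>B\<in>L. A \<subseteq> B \<or> B \<subseteq> A) \<and>
      card L + 1 = card X \<and> (2 \<le> card X \<longrightarrow> X \<in> L)"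
    using part_nonempty[OF P] by (intro ballI chain_exists) auto
  then obtain L where L: "\<forall>X\<in>P. (\<forall>A\<in>L X. A \<subseteq> X \<and> 2 \<le> card A) \<and>
      (\<forall>A\<in>L X. \<forall>B\<in>L X. A \<subseteq> B \<or> B \<subseteq> A) \<and> card (L X) + 1 = card X \<and> (2 \<le> card X \<longrightarrow> X \<in> L X)"
    by (rule bchoice[THEN exE])
  have sub: "A \<subseteq> X" "2 \<le> card A" "2 \<le> card (- A)" if "A \<in> L X" "X \<in> P" for A X
  proof -
    show "A \<subseteq> X" "2 \<le> card A"
      using L[rule_format, OF that(2)] that(1) by simp_all
    then show "2 \<le> card (- A)"
      using card_compl_sub_part[OF P that(2)] by simp
  qed
  define \<sigma> where "\<sigma> = bd ` (\<Union>X\<in>P. L X)"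
  have "inj_on bd (\<Union>X\<in>P. L X)"
  proof (rule inj_onI)
    fix A A' assume "A \<in> (\<Union>X\<in>P. L X)" "A' \<in> (\<Union>X\<in>P. L X)" and eq: "bd A = bd A'"
    then obtain X X' where X: "A \<in> L X" "X \<in> P" "A' \<in> L X'" "X' \<in> P"
      by blast
    have "A = A' \<or> A = - A'"
      using eq bd_eq_iff[OF sub(2,3)[OF X(1,2)] sub(2,3)[OF X(3,4)]] by blast
    moreover have "A \<noteq> - A'"
      using sub(1)[OF X(1,2)] sub(1)[OF X(3,4)] third_part[OF P X(2,4)] by blast
    ultimately show "A = A'"
      by blast
  qed
  then have "card \<sigma> = card (\<Union>X\<in>P. L X)"
    unfolding \<sigma>_def by (rule card_image)
  also have "\<dots> = (\<Sum>X\<in>P. card (L X))"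
  proof (rule card_UN_disjoint)
    show "\<forall>X\<in>P. \<forall>Y\<in>P. X \<noteq> Y \<longrightarrow> L X \<inter> L Y = {}"
    proof (intro ballI impI)
      fix X Y assume XY: "X \<in> P" "Y \<in> P" "X \<noteq> Y"
      have False if "A \<in> L X" "A \<in> L Y" for A
      proof -
        have "A \<noteq> {}"
          using sub(2)[OF that(1) XY(1)] by auto
        then obtain x where "x \<in> A"
          by blast
        then show False
          using four_partsD(5)[OF P XY(1,2), of x] sub(1)[OF that(1) XY(1)] sub(1)[OF that(2) XY(2)] XY(3)
          by blast
      qed
      then show "L X \<inter> L Y = {}"
        by blast
    qed
  qed simp_all
  finally have "card \<sigma> + 4 = (\<Sum>X\<in>P. card (L X) + 1)"
    using four_partsD(1)[OF P] by (simp add: sum.distrib del: One_nat_def)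
  also have "\<dots> = (\<Sum>X\<in>P. card X)"
    using L by (intro sum.cong) auto
  finally have "card \<sigma> = 3"
    using sum_card_parts[OF P] by simp
  moreover have "meets J K" if JK: "J \<in> \<sigma>" "K \<in> \<sigma>" for J K
  proof -
    obtain A X B Y where X: "J = bd A" "A \<in> L X" "X \<in> P" "K = bd B" "B \<in> L Y" "Y \<in> P"
      using JK unfolding \<sigma>_def by blast
    have "A \<subseteq> B \<or> B \<subseteq> A \<or> A \<inter> B = {}"
    proof (cases "X = Y")
      case True
      then show ?thesis using L[rule_format, OF X(3)] X(2,5) by blast
    next
      case False
      then have "X \<inter> Y = {}"
        using four_partsD(5)[OF P X(3,6)] by blast
      then show ?thesis
        using sub(1)[OF X(2,3)] sub(1)[OF X(5,6)] by blast
    qed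
    then show ?thesis
      unfolding X(1,4) meets_bd[OF sub(2,3)[OF X(2,3)] sub(2,3)[OF X(5,6)]] by blast
  qed
  moreover have "bd X \<in> \<sigma>" if "X \<in> P" "2 \<le> card X" for X
  proof -
    have "X \<in> L X"
      using L[rule_format, OF that(1)] that(2) by simp
    then show ?thesis
      unfolding \<sigma>_def using that(1) by (intro imageI UN_I)
  qed
  moreover have "\<exists>A\<in>sides J. \<exists>B\<in>P. A \<subseteq> B" if J: "J \<in> \<sigma>" for J
  proof -
    obtain A X where X: "J = bd A" "A \<in> L X" "X \<in> P"
      using J unfolding \<sigma>_def by blast
    then show ?thesis
      using sides_bd[OF sub(2,3)[OF X(2,3)]] sub(1)[OF X(2,3)] by blast
  qed
  ultimately show ?thesis
    using P unfolding one_dim_stratum_def branches_def by blast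
qed

lemma partition_of_stratum:
  assumes \<sigma>: "one_dim_stratum \<sigma>"
  shows "\<exists>P. branches \<sigma> P"
proof -
  define r where "r = (0 :: 7)"
  define AA where "AA = {A. r \<notin> A \<and> (\<exists>J\<in>\<sigma>. A \<in> sides J)}"
  define top where "top = - {r}"
  define V where "V = insert top AA"
  define F where "F = V \<union> (\<lambda>x. {x}) ` top"
  define kids where "kids = (\<lambda>X. {Y \<in> F. Y \<subset> X \<and> (\<forall>Z\<in>F. Y \<subset> Z \<longrightarrow> \<not> Z \<subset> X)})"
  have card_top: "card top = 6"
    by (simp add: top_def card_compl7)
  have AA: "bd A \<in> \<sigma>" "2 \<le> card A" "2 \<le> card (- A)" "A \<subseteq> top" if "A \<in> AA" for A
    using that in_sides_bd[of A] by (auto simp: AA_def top_def)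
  have "bij_betw bd AA \<sigma>"
  proof (rule bij_betw_imageI)
    show "inj_on bd AA"
    proof (rule inj_onI)
      fix A B assume AB: "A \<in> AA" "B \<in> AA" "bd A = bd B"
      then have "A = B \<or> A = - B"
        using bd_eq_iff[OF AA(2,3) AA(2,3)] by blast
      with AB show "A = B"
        by (auto simp: AA_def)
    qed
    show "bd ` AA = \<sigma>"
    proof (intro equalityI subsetI)
      fix J assume J: "J \<in> \<sigma>"
      obtain T where T: "J = bd T" "sides J = {T, - T}"
        by (rule boundary_cases)
      show "J \<in> bd ` AA"
      proof (cases "r \<in> T")
        case True
        then have "- T \<in> AA"
          using J T by (auto simp: AA_def)
        then show ?thesis
          using T bd_compl by (metis image_eqI)
      next
        case False
        then have "T \<in> AA"
          using J T by (auto simp: AA_def)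
        then show ?thesis
          using T by blast
      qed
    qed (use AA(1) in blast)
  qed
  then have cardAA: "card AA = 3"
    using \<sigma> by (simp add: bij_betw_same_card one_dim_stratum_def)
  have topAA: "top \<notin> AA"
    using AA(3)[of top] by (auto simp: top_def)
  have cardV: "card V = 4"
    using cardAA topAA by (simp add: V_def)
  have V: "2 \<le> card X" "X \<subseteq> top" if "X \<in> V" for X
    using that AA(2,4)[of X] card_top unfolding V_def by auto
  have VF: "V \<subseteq> F"
    by (auto simp: F_def)
  have Ftop: "X \<subseteq> top" "X \<noteq> {}" if "X \<in> F" for X
    using that V[of X] unfolding F_def by auto
  have FV: "X \<in> V" if "X \<in> F" "2 \<le> card X" for X
    using that unfolding F_def by auto
  have cardF: "card F = 10"
  proof -
    have "V \<inter> (\<lambda>x. {x}) ` top = {}"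
      using V(1) by fastforce
    then have "card F = card V + card ((\<lambda>x. {x}) ` top)"
      unfolding F_def by (intro card_Un_disjoint) simp_all
    then show ?thesis
      using cardV card_top by (simp add: card_image)
  qed
  have lam: "X \<subseteq> Y \<or> Y \<subseteq> X \<or> X \<inter> Y = {}" if XY: "X \<in> F" "Y \<in> F" for X Y
  proof (cases "X \<in> AA \<and> Y \<in> AA")
    case True
    then obtain J K where "J \<in> \<sigma>" "K \<in> \<sigma>" "X \<in> sides J" "Y \<in> sides K" and r: "r \<notin> X \<union> Y"
      by (auto simp: AA_def)
    then have "X \<subseteq> Y \<or> Y \<subseteq> X \<or> X \<inter> Y = {} \<or> X \<union> Y = UNIV"
      using \<sigma> by (intro meets_sides[of J K]) (auto simp: one_dim_stratum_def)
    with r show ?thesis by blast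
  next
    case False
    then have "X = top \<or> Y = top \<or> (\<exists>x. X = {x}) \<or> (\<exists>y. Y = {y})"
      using XY by (auto simp: F_def V_def)
    then show ?thesis
      using Ftop(1)[OF XY(1)] Ftop(1)[OF XY(2)] by blast
  qed
  have kidsD: "Y \<in> F" "Y \<subset> X" "\<And>Z. Z \<in> F \<Longrightarrow> Y \<subset> Z \<Longrightarrow> \<not> Z \<subset> X" if "Y \<in> kids X" for X Y
    using that by (auto simp: kids_def)
  have kid_above: "\<exists>Z\<in>kids X. Y \<subseteq> Z" if Y: "Y \<in> F" "Y \<subset> X" for X Y
  proof -
    have fin: "finite {Z \<in> F. Z \<subset> X}" "Y \<in> {Z \<in> F. Z \<subset> X}"
      using Y by simp_all
    obtain M where M: "M \<in> {Z \<in> F. Z \<subset> X}" "Y \<subseteq> M" "\<forall>Z\<in>{Z \<in> F. Z \<subset> X}. M \<subseteq> Z \<longrightarrow> M = Z"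
      using finite_has_maximal2[OF fin] by (elim bexE conjE)
    then have "M \<in> kids X"
      by (auto simp: kids_def)
    with M(2) show ?thesis by blast
  qed
  have kid_of: "\<exists>K\<in>kids X. x \<in> K" if X: "X \<in> V" "x \<in> X" for X x
  proof -
    have "{x} \<in> F"
      using V(2)[OF X(1)] X(2) by (auto simp: F_def)
    moreover have "{x} \<noteq> X"
      using V(1)[OF X(1)] by auto
    ultimately show ?thesis
      using kid_above[of "{x}" X] X(2) by blast
  qed
  have kid_unique: "Y = Z" if Y: "Y \<in> kids X" "Z \<in> kids X" "y \<in> Y" "y \<in> Z" for X Y Z y
  proof -
    have "Y \<subseteq> Z \<or> Z \<subseteq> Y"
      using lam[OF kidsD(1)[OF Y(1)] kidsD(1)[OF Y(2)]] Y(3,4) by blast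
    then show ?thesis
      using kidsD(3)[OF Y(1) kidsD(1)[OF Y(2)]] kidsD(3)[OF Y(2) kidsD(1)[OF Y(1)]]
        kidsD(2)[OF Y(1)] kidsD(2)[OF Y(2)] by blast
  qed
  have two_kids: "2 \<le> card (kids X)" if X: "X \<in> V" for X
  proof -
    have "X \<noteq> {}"
      using V(1)[OF X] by auto
    then obtain x where x: "x \<in> X"
      by blast
    obtain K where K: "K \<in> kids X" "x \<in> K"
      using kid_of[OF X x] by blast
    then obtain y where y: "y \<in> X" "y \<notin> K"
      using kidsD(2)[OF K(1)] by blast
    obtain K' where K': "K' \<in> kids X" "y \<in> K'"
      using kid_of[OF X y(1)] by blast
    have "K \<noteq> K'"
      using y(2) K'(2) by blast
    then have "card {K, K'} = 2"
      by simp
    moreover have "card {K, K'} \<le> card (kids X)"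
      using K(1) K'(1) by (intro card_mono) simp_all
    ultimately show ?thesis by simp
  qed
  have kids_disj: "X = X'" if Y: "Y \<in> kids X" "Y \<in> kids X'" "X \<in> V" "X' \<in> V" for X X' Y
  proof -
    obtain y where "y \<in> Y"
      using Ftop(2)[OF kidsD(1)[OF Y(1)]] by blast
    then have "X \<subseteq> X' \<or> X' \<subseteq> X"
      using lam[of X X'] VF Y kidsD(2)[OF Y(1)] kidsD(2)[OF Y(2)] by blast
    moreover have "\<not> X \<subset> X'" "\<not> X' \<subset> X"
      using kidsD(3)[OF Y(2), of X] kidsD(3)[OF Y(1), of X'] kidsD(2)[OF Y(1)] kidsD(2)[OF Y(2)]
        VF Y(3,4) by blast+
    ultimately show ?thesis by blast
  qed
  have parents: "F - {top} = (\<Union>X\<in>V. kids X)"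
  proof (intro equalityI subsetI)
    fix Y assume "Y \<in> F - {top}"
    then have Y: "Y \<in> F" "Y \<subset> top" "Y \<noteq> {}"
      using Ftop by auto
    have fin: "finite {X \<in> V. Y \<subset> X}" "top \<in> {X \<in> V. Y \<subset> X}"
      using Y(2) by (simp_all add: V_def)
    obtain M where M: "M \<in> {X \<in> V. Y \<subset> X}" "\<forall>X\<in>{X \<in> V. Y \<subset> X}. X \<subseteq> M \<longrightarrow> M = X"
      using finite_has_minimal2[OF fin] by (elim bexE conjE)
    have "\<not> Z \<subset> M" if Z: "Z \<in> F" "Y \<subset> Z" for Z
    proof -
      have "card Y < card Z"
        using Z(2) by (intro psubset_card_mono) simp_all
      moreover have "card Y \<noteq> 0"
        using Y(3) by simp
      ultimately have "Z \<in> V"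
        using Z(1) by (intro FV) linarith+
      then show ?thesis
        using M(2) Z(2) by blast
    qed
    then have "Y \<in> kids M"
      using M(1) Y(1) by (auto simp: kids_def)
    then show "Y \<in> (\<Union>X\<in>V. kids X)"
      using M(1) by blast
  next
    fix Y assume "Y \<in> (\<Union>X\<in>V. kids X)"
    then obtain X where X: "X \<in> V" "Y \<in> kids X"
      by blast
    then show "Y \<in> F - {top}"
      using kidsD(1,2)[OF X(2)] V(2)[OF X(1)] by blast
  qed
  have "(\<Sum>X\<in>V. card (kids X)) = card (\<Union>X\<in>V. kids X)"
  proof (rule card_UN_disjoint[symmetric])
    show "\<forall>X\<in>V. \<forall>X'\<in>V. X \<noteq> X' \<longrightarrow> kids X \<inter> kids X' = {}"
      using kids_disj by (simp only: disjoint_iff) metis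
  qed simp_all
  also have "\<dots> = 9"
  proof -
    have "top \<in> F"
      using VF by (simp add: V_def)
    then show ?thesis
      unfolding parents[symmetric] using cardF by simp
  qed
  finally have nine: "(\<Sum>X\<in>V. card (kids X)) = 9" .
  have "\<exists>X\<in>V. card (kids X) \<noteq> 2"
  proof (rule ccontr)
    assume "\<not> (\<exists>X\<in>V. card (kids X) \<noteq> 2)"
    then have "(\<Sum>X\<in>V. card (kids X)) = (\<Sum>X\<in>V. 2)"
      by (intro sum.cong) auto
    with nine cardV show False by simp
  qed
  then obtain X where X: "X \<in> V" "card (kids X) \<noteq> 2"
    by blast
  have "(\<Sum>Y\<in>V - {X}. 2) \<le> (\<Sum>Y\<in>V - {X}. card (kids Y))"
    using two_kids by (intro sum_mono) simp
  then have "6 \<le> (\<Sum>Y\<in>V - {X}. card (kids Y))"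
    using X(1) cardV by simp
  moreover have "(\<Sum>Y\<in>V. card (kids Y)) = card (kids X) + (\<Sum>Y\<in>V - {X}. card (kids Y))"
    using X(1) by (simp add: sum.remove)
  ultimately have three: "card (kids X) = 3"
    using nine two_kids[OF X(1)] X(2) by linarith
  define P where "P = insert (- X) (kids X)"
  have rX: "r \<in> - X"
    using V(2)[OF X(1)] by (auto simp: top_def)
  have notin: "- X \<notin> kids X"
    using rX Ftop(1) kidsD(1) by (metis Compl_iff insertI1 subsetD top_def)
  have "four_parts P"
  proof -
    have "card P = 4"
      using three notin by (simp add: P_def)
    moreover have "\<Union>P = UNIV"
    proof -
      have "x \<in> \<Union>P" for x
        using kid_of[OF X(1), of x] by (cases "x \<in> X") (auto simp: P_def)
      then show ?thesis by blast
    qed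
    moreover have "{} \<notin> P"
      using rX Ftop(2) kidsD(1) by (auto simp: P_def)
    moreover have "disjoint P"
    proof (rule disjointI)
      fix A B assume AB: "A \<in> P" "B \<in> P" "A \<noteq> B"
      have "A \<inter> - X = {}" if "A \<in> kids X" for A
        using kidsD(2)[OF that] by blast
      then show "A \<inter> B = {}"
        using AB kid_unique[of A X B] by (auto simp: P_def)
    qed
    ultimately show ?thesis
      by (simp add: four_parts_def partition_on_def)
  qed
  moreover have "bd A \<in> \<sigma>" if A: "A \<in> P" "2 \<le> card A" for A
  proof (cases "A = - X")
    case True
    then have "X \<noteq> top"
      using A(2) by (auto simp: top_def)
    then have "X \<in> AA"
      using X(1) by (simp add: V_def)
    then show ?thesis
      using AA(1) True by (simp add: bd_compl)
  next
    case False
    then have k: "A \<in> kids X"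
      using A(1) by (simp add: P_def)
    then have "A \<in> V" "A \<noteq> top"
      using FV[OF kidsD(1)[OF k] A(2)] kidsD(2)[OF k] V(2)[OF X(1)] by blast+
    then show ?thesis
      using AA(1) by (simp add: V_def)
  qed
  moreover have "\<exists>A\<in>sides J. \<exists>B\<in>P. A \<subseteq> B" if J: "J \<in> \<sigma>" for J
  proof -
    obtain A where A: "A \<in> AA" "J = bd A"
      using J \<open>bij_betw bd AA \<sigma>\<close> by (auto simp: bij_betw_def)
    have s: "sides J = {A, - A}"
      using sides_bd[OF AA(2,3)[OF A(1)]] A(2) by simp
    have "A \<subseteq> X \<or> X \<subseteq> A \<or> A \<inter> X = {}"
      using lam[of A X] A(1) X(1) VF by (auto simp: V_def)
    then consider "A \<subset> X" | "- A \<subseteq> - X" | "A \<subseteq> - X"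
      by blast
    then show ?thesis
    proof cases
      case 1
      then obtain K where "K \<in> kids X" "A \<subseteq> K"
        using kid_above[of A X] A(1) by (auto simp: F_def V_def)
      then show ?thesis
        unfolding s P_def by blast
    qed (auto simp: s P_def)
  qed
  ultimately show ?thesis
    unfolding branches_def by blast
qed

lemma stratum_split:
  assumes \<sigma>: "one_dim_stratum \<sigma>" and T: "J \<in> \<sigma>" "T \<in> sides J"
  obtains i j where "i \<in> T" "j \<in> T" "i \<noteq> j"
    "\<And>K U. K \<in> \<sigma> \<Longrightarrow> U \<in> sides K \<Longrightarrow> U \<subset> T \<Longrightarrow> i \<in> U \<Longrightarrow> j \<notin> U"
proof -
  define UU where "UU = {U. U \<subset> T \<and> (\<exists>K\<in>\<sigma>. U \<in> sides K)}"
  have cT: "2 \<le> card T" "2 \<le> card (- T)"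
    using in_sides_bd[OF T(2)] by simp_all
  show thesis
  proof (cases "UU = {}")
    case True
    obtain i j where "i \<in> T" "j \<in> T" "i \<noteq> j"
      using cT(1) card_le_Suc0_iff_eq[of T] by fastforce
    with True that show thesis
      by (auto simp: UU_def)
  next
    case False
    then obtain M where M: "M \<in> UU" "\<forall>U\<in>UU. M \<subseteq> U \<longrightarrow> M = U"
      using finite_has_maximal[of UU] by auto
    obtain K where K: "K \<in> \<sigma>" "M \<in> sides K" "M \<subset> T"
      using M(1) by (auto simp: UU_def)
    have "M \<noteq> {}"
      using in_sides_bd[OF K(2)] by auto
    then obtain i j where ij: "i \<in> M" "j \<in> T" "j \<notin> M"
      using K(3) by blast
    show thesis
    proof (rule that)
      show "i \<in> T" "j \<in> T" "i \<noteq> j"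
        using ij K(3) by auto
      fix K' U assume U: "K' \<in> \<sigma>" "U \<in> sides K'" "U \<subset> T" "i \<in> U"
      have "M \<subseteq> U \<or> U \<subseteq> M \<or> M \<inter> U = {} \<or> M \<union> U = UNIV"
        using \<sigma> U K by (intro meets_sides[of K K']) (auto simp: one_dim_stratum_def)
      moreover have "M \<union> U \<noteq> UNIV"
      proof
        assume "M \<union> U = UNIV"
        then have "- T = {}"
          using U(3) K(3) by blast
        with cT(2) show False by simp
      qed
      moreover have "U \<in> UU"
        using U by (auto simp: UU_def)
      ultimately show "j \<notin> U"
        using M(2) ij U(4) by blast
    qed
  qed
qed

lemma linear_cls: "Vector_Spaces.linear (*s) nscale cls"
  by unfold_locales (simp_all add: plus_NS.abs_eq nscale.abs_eq)

lemma linear_NS_cls: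
  assumes "Vector_Spaces.linear nscale (*) (\<phi> :: NS \<Rightarrow> rat)"
  shows "\<phi> (cls (D + E)) = \<phi> (cls D) + \<phi> (cls E)" "\<phi> (cls (c *s D)) = c * \<phi> (cls D)"
    "\<phi> (cls (\<Sum>x\<in>X. f x)) = (\<Sum>x\<in>X. \<phi> (cls (f x)))"
proof -
  interpret \<phi>: Vector_Spaces.linear nscale "(*)" \<phi>
    by fact
  interpret cls: Vector_Spaces.linear "(*s)" nscale cls
    by (rule linear_cls)
  show "\<phi> (cls (D + E)) = \<phi> (cls D) + \<phi> (cls E)" "\<phi> (cls (c *s D)) = c * \<phi> (cls D)"
    "\<phi> (cls (\<Sum>x\<in>X. f x)) = (\<Sum>x\<in>X. \<phi> (cls (f x)))"
    by (simp_all add: cls.add \<phi>.add cls.scale \<phi>.scale cls.sum \<phi>.sum)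
qed

lemma linear_NS_eqI:
  assumes "Vector_Spaces.linear nscale (*) (\<phi> :: NS \<Rightarrow> rat)" "Vector_Spaces.linear nscale (*) \<psi>"
    and "\<And>J. \<phi> (cls (axis J 1)) = \<psi> (cls (axis J 1))"
  shows "\<phi> = \<psi>"
proof
  fix d
  obtain D where d: "d = cls D"
    by (rule cls_surj)
  have D: "D = (\<Sum>J\<in>UNIV. D $ J *s axis J 1)"
    by (rule basis_expansion[symmetric])
  show "\<phi> d = \<psi> d"
    unfolding d by (subst (1 2) D) (simp only: linear_NS_cls[OF assms(1)] linear_NS_cls[OF assms(2)] assms(3))
qed

lemma linear_NS_separating:
  assumes "Vector_Spaces.linear nscale (*) (\<phi> :: NS \<Rightarrow> rat)" "card {i, j, k, l} = 4"
  shows "\<phi> (cls (separating {i, j} {k, l})) = \<phi> (cls (separating {i, k} {j, l}))"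
proof -
  have "separating {i, j} {k, l} - separating {i, k} {j, l} \<in> keel_relations"
    using assms(2) unfolding keel_relations_def by blast
  then have "cls (separating {i, j} {k, l}) = cls (separating {i, k} {j, l})"
    by (simp add: cls_eq_iff vec.span_base)
  then show ?thesis by simp
qed

lemma curve_class_unique:
  assumes \<sigma>: "one_dim_stratum \<sigma>" and \<phi>: "curve_class \<sigma> \<phi>" and \<psi>: "curve_class \<sigma> \<psi>"
  shows "\<phi> = \<psi>"
proof (rule linear_NS_eqI)
  show lin: "Vector_Spaces.linear nscale (*) \<phi>" "Vector_Spaces.linear nscale (*) \<psi>"
    using \<phi> \<psi> by (simp_all add: curve_class_def)
  have out: "\<phi> (cls (axis J 1)) = \<psi> (cls (axis J 1))" if "J \<notin> \<sigma>" for J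
    using \<phi> \<psi> that by (simp add: curve_class_def)
  fix J
  show "\<phi> (cls (axis J 1)) = \<psi> (cls (axis J 1))"
  proof (cases "J \<in> \<sigma>")
    case True
    obtain T where T: "J = bd T" "2 \<le> card T" "2 \<le> card (- T)" "sides J = {T, - T}"
      by (rule boundary_cases)
    have s: "T \<in> sides J" "- T \<in> sides J"
      using T(4) by simp_all
    obtain i j where ij: "i \<in> T" "j \<in> T" "i \<noteq> j"
        "\<And>K U. K \<in> \<sigma> \<Longrightarrow> U \<in> sides K \<Longrightarrow> U \<subset> T \<Longrightarrow> i \<in> U \<Longrightarrow> j \<notin> U"
      using stratum_split[OF \<sigma> True s(1)] by blast
    obtain k l where kl: "k \<in> - T" "l \<in> - T" "k \<noteq> l"
        "\<And>K U. K \<in> \<sigma> \<Longrightarrow> U \<in> sides K \<Longrightarrow> U \<subset> - T \<Longrightarrow> k \<in> U \<Longrightarrow> l \<notin> U"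
      using stratum_split[OF \<sigma> True s(2)] by blast
    have d: "card {i, j, k, l} = 4" "card {i, k, j, l} = 4"
      using ij kl by (auto simp: card4_iff)
    define Ts where
      "Ts = (\<lambda>a b c d. {U :: 7 set. 2 \<le> card U \<and> 2 \<le> card (- U) \<and> {a, b} \<subseteq> U \<and> {c, d} \<subseteq> - U})"
    have U: "U \<subseteq> T \<or> T \<subseteq> U \<or> U \<inter> T = {} \<or> U \<union> T = UNIV" "U \<in> sides (bd U)" "- U \<in> sides (bd U)"
      if "bd U \<in> \<sigma>" "2 \<le> card U" "2 \<le> card (- U)" for U
    proof -
      show U: "U \<in> sides (bd U)" "- U \<in> sides (bd U)"
        using sides_bd[OF that(2,3)] by simp_all
      show "U \<subseteq> T \<or> T \<subseteq> U \<or> U \<inter> T = {} \<or> U \<union> T = UNIV"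
        using \<sigma> True that(1) U(1) s(1) by (intro meets_sides[of "bd U" J]) (auto simp: one_dim_stratum_def)
    qed
    have cross: "bd U \<notin> \<sigma>" if "U \<in> Ts i k j l" for U
      using U(1)[of U] that ij(1,2) kl(1,2) by (auto simp: Ts_def)
    have only: "bd U \<notin> \<sigma>" if Ui: "U \<in> Ts i j k l" "U \<noteq> T" for U
    proof
      assume b: "bd U \<in> \<sigma>"
      have c: "2 \<le> card U" "2 \<le> card (- U)" and m: "i \<in> U" "j \<in> U" "k \<in> - U" "l \<in> - U"
        using Ui by (auto simp: Ts_def)
      have "U \<subset> T \<or> - U \<subset> - T"
        using U(1)[OF b c] m ij(1) kl(1) Ui(2) by blast
      then show False
        using ij(4)[OF b U(2)[OF b c]] kl(4)[OF b U(3)[OF b c]] m by blast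
    qed
    have sep: "\<theta> (cls (separating {a, b} {c, d})) = (\<Sum>U\<in>Ts a b c d. \<theta> (cls (axis (bd U) 1)))"
      if "Vector_Spaces.linear nscale (*) (\<theta> :: NS \<Rightarrow> rat)" for \<theta> a b c d
      unfolding separating_def Ts_def Delta_def by (rule linear_NS_cls(3)[OF that])
    have TT: "T \<in> Ts i j k l"
      using T(2,3) ij(1,2) kl(1,2) by (auto simp: Ts_def)
    have val: "\<theta> (cls (axis J 1)) =
        (\<Sum>U\<in>Ts i k j l. \<theta> (cls (axis (bd U) 1))) - (\<Sum>U\<in>Ts i j k l - {T}. \<theta> (cls (axis (bd U) 1)))"
      if "Vector_Spaces.linear nscale (*) (\<theta> :: NS \<Rightarrow> rat)" for \<theta>
    proof -
      have "(\<Sum>U\<in>Ts i j k l. \<theta> (cls (axis (bd U) 1))) = (\<Sum>U\<in>Ts i k j l. \<theta> (cls (axis (bd U) 1)))"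
        using linear_NS_separating[OF that d(1)] unfolding sep[OF that] .
      moreover have "(\<Sum>U\<in>Ts i j k l. \<theta> (cls (axis (bd U) 1))) =
          \<theta> (cls (axis (bd T) 1)) + (\<Sum>U\<in>Ts i j k l - {T}. \<theta> (cls (axis (bd U) 1)))"
        using TT by (simp add: sum.remove)
      ultimately show ?thesis
        unfolding T(1) by simp
    qed
    have "(\<Sum>U\<in>Ts i k j l. \<phi> (cls (axis (bd U) 1))) = (\<Sum>U\<in>Ts i k j l. \<psi> (cls (axis (bd U) 1)))"
      "(\<Sum>U\<in>Ts i j k l - {T}. \<phi> (cls (axis (bd U) 1))) = (\<Sum>U\<in>Ts i j k l - {T}. \<psi> (cls (axis (bd U) 1)))"
      using out cross only by (auto intro!: sum.cong)
    then show ?thesis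
      unfolding val[OF lin(1)] val[OF lin(2)] by simp
  qed (rule out)
qed

lemma curve_class_F_number:
  assumes "one_dim_stratum \<sigma>" "branches \<sigma> P"
  shows "curve_class \<sigma> (F_number P)"
proof -
  have P: "four_parts P"
    using assms(2) by (simp add: branches_def)
  show ?thesis
    unfolding curve_class_def
    using linear_F_number[OF P] branch_number_transversal[OF assms]
    by (simp add: F_number_cls[OF P] pairing_axis)
qed

theorem ex1_curve_class:
  assumes "one_dim_stratum \<sigma>"
  shows "\<exists>!\<phi>. curve_class \<sigma> \<phi>"
  using partition_of_stratum[OF assms] curve_class_F_number[OF assms] curve_class_unique[OF assms]
  by blast

theorem F_curves_eq: "F_curves = {F_number P | P. partition_on UNIV P \<and> card P = 4}"
proof -
  have "\<phi> \<in> F_curves \<longleftrightarrow> (\<exists>P. four_parts P \<and> \<phi> = F_number P)" for \<phi>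
  proof
    assume "\<phi> \<in> F_curves"
    then obtain \<sigma> where \<sigma>: "one_dim_stratum \<sigma>" "curve_class \<sigma> \<phi>"
      by (auto simp: F_curves_def)
    then obtain P where "branches \<sigma> P"
      using partition_of_stratum by blast
    then show "\<exists>P. four_parts P \<and> \<phi> = F_number P"
      using curve_class_unique[OF \<sigma>] curve_class_F_number[OF \<sigma>(1)] by (auto simp: branches_def)
  next
    assume "\<exists>P. four_parts P \<and> \<phi> = F_number P"
    then obtain P where P: "four_parts P" "\<phi> = F_number P"
      by blast
    then show "\<phi> \<in> F_curves"
      using stratum_of_partition[OF P(1)] curve_class_F_number by (auto simp: F_curves_def)
  qed
  then show ?thesis
    by (auto simp: four_parts_def)
qed

end

theory Submission
  imports Defs
begin

text \<open>
  The coefficient of \<open>D\<close> at a boundary divisor \<open>\<Delta>\<^sub>J\<close> is a non-negative combination of intersection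
  numbers of \<open>D\<close> with F-curves, with weights that depend on \<open>card J\<close> only. Passing to the complement,
  \<open>J\<close> has two or three elements.

  The curves that can occur are forced. The coefficient of \<open>S\<^sub>I\<close> at \<open>\<Delta>\<^sub>J\<close> is \<open>1/3\<close> if
  \<open>card (I \<inter> J) = 2\<close> and zero otherwise, while a curve with partition \<open>P\<close> meets \<open>S\<^sub>I\<close> once if \<open>I\<close>
  contains a point of each part of \<open>P\<close>, and not at all otherwise. So all sets that contain exactly
  one point of each part must have two points in \<open>J\<close>; that is, \<open>P\<close> must split both \<open>J\<close> and \<open>- J\<close>
  into two parts. Let one part be \<open>{y}\<close> with \<open>y \<in> J\<close>, and another \<open>X \<subseteq> - J\<close> with one or two elements.
  A weight \<open>a\<close> for every pair \<open>(y, X)\<close> with \<open>card X = 1\<close> and \<open>b\<close> for every pair with \<open>card X = 2\<close>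
  reproduces the coefficients of all \<open>S\<^sub>I\<close> if \<open>4 * a + 4 * (card (- J) - 2) * b = 1/3\<close>
  (\<open>splitting_sum_keel_divisor\<close>).

  Call the coefficient minus the weighted sum the defect at \<open>J\<close>. It is linear and vanishes on every
  \<open>S\<^sub>I\<close>. The second condition on \<open>a\<close> and \<open>b\<close> is that the defect of \<open>D\<^sub>i\<close> is the same for all \<open>i\<close>
  (\<open>defect_Dpt\<close>). The two conditions have a positive solution: \<open>a = 1/30\<close>, \<open>b = 1/60\<close> if
  \<open>card J = 2\<close>, and \<open>a = 1/40\<close>, \<open>b = 7/240\<close> if \<open>card J = 3\<close>. The relations
  \<open>\<Sum>\<^sub>i D\<^sub>i = 2 B\<^sub>2\<close> and \<open>\<Sum>\<^sub>I S\<^sub>I = 10/3 B\<^sub>2 + 6 B\<^sub>3\<close> then show that the defects of \<open>D\<^sub>i\<close>, \<open>B\<^sub>2\<close>, \<open>B\<^sub>3\<close>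
  are proportional to \<open>18\<close>, \<open>63\<close>, \<open>- 35\<close>. So the hypothesis \<open>18 * \<alpha> + 63 * lam - 35 * \<mu> = 0\<close> makes
  the defect of every \<open>P\<^sub>i\<close> vanish. Hence the coefficient of \<open>D\<close> at
  \<open>\<Delta>\<^sub>J\<close> equals the weighted sum, which is non-negative because \<open>D\<close> is F-nef.
\<close>

section \<open>Keel divisors and divisors of pairs\<close>

text \<open>
  The branch number of a union of parts is \<open>1\<close> or \<open>- 1\<close> according to the parity of the number of
  parts. A pair is the union of two singleton parts, or a part, or not a union of parts.
\<close>

lemma branch_number_pair:
  assumes P: "four_parts P" and "i \<noteq> j"
  shows "branch_number P (bd {i, j}) = of_bool ({i} \<in> P \<and> {j} \<in> P) - of_bool ({i, j} \<in> P)"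
proof -
  have c: "2 \<le> card {i, j}" "2 \<le> card (- {i, j})"
    using assms(2) by (simp_all add: card_compl7)
  note part = four_partsD(5)[OF P]
  consider "{i, j} \<in> P" | "{i} \<in> P" "{j} \<in> P" | "{i, j} \<notin> P" "\<not> ({i} \<in> P \<and> {j} \<in> P)"
    by blast
  then show ?thesis
  proof cases
    case 1
    then have "{i} \<notin> P"
      using part[of "{i}" "{i, j}" i] assms(2) by blast
    with 1 show ?thesis
      using branch_number_Union[OF P, of "{{i, j}}"] c by simp
  next
    case 2
    then have "{i, j} \<notin> P"
      using part[of "{i}" "{i, j}" i] assms(2) by blast
    moreover have "{{i}, {j}} \<subseteq> P" "\<Union>{{i}, {j}} = {i, j}" "card {{i}, {j}} = 2"
      using 2 assms(2) by auto
    ultimately show ?thesis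
      using branch_number_Union[OF P, of "{{i}, {j}}"] c 2 by simp
  next
    case 3
    have "{i, j} \<noteq> \<Union>Q" if Q: "Q \<subseteq> P" for Q
    proof
      assume e: "{i, j} = \<Union>Q"
      then have "i \<in> \<Union>Q" "j \<in> \<Union>Q"
        by (simp_all flip: e)
      then obtain A B where A: "A \<in> Q" "i \<in> A" and B: "B \<in> Q" "j \<in> B"
        by (elim UnionE)
      have "A \<subseteq> {i, j}" "B \<subseteq> {i, j}"
        unfolding e using A(1) B(1) by (simp_all add: Union_upper)
      then have "A = {i} \<or> A = {i, j}" "B = {j} \<or> B = {i, j}"
        using A(2) B(2) by auto
      with A(1) B(1) Q 3 show False
        by blast
    qed
    then show ?thesis
      using branch_number_other[OF P c] 3 by simp
  qed
qed

lemma card_4_obtain: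
  assumes "card I = 4"
  obtains i j k l :: 7 where "I = {i, j, k, l}" "card {i, j, k, l} = 4"
proof -
  obtain xs where "set xs = I" "length xs = 4"
    using finite_distinct_list[of I] assms distinct_card by (metis finite)
  moreover from this obtain i j k l where "xs = [i, j, k, l]"
    by (auto simp: length_Suc_conv numeral_eq_Suc)
  ultimately show thesis
    using that assms by force
qed

lemma separating_coeff:
  assumes T: "2 \<le> card T" "2 \<le> card (- T)"
  shows "separating A B $ bd T = of_bool (A \<subseteq> T \<and> B \<subseteq> - T) + of_bool (A \<subseteq> - T \<and> B \<subseteq> T)"
proof -
  define V where "V = {U :: 7 set. 2 \<le> card U \<and> 2 \<le> card (- U) \<and> A \<subseteq> U \<and> B \<subseteq> - U}"
  have ne: "T \<noteq> - T"
    using T(1) by auto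
  have "separating A B $ bd T = (\<Sum>U\<in>V. Delta U $ bd T)"
    by (simp add: separating_def V_def)
  also have "\<dots> = (\<Sum>U\<in>V. of_bool (U = T) + of_bool (U = - T))"
  proof (rule sum.cong)
    fix U assume "U \<in> V"
    then have "bd T = bd U \<longleftrightarrow> T = U \<or> T = - U"
      using T by (intro bd_eq_iff) (auto simp: V_def)
    then show "Delta U $ bd T = of_bool (U = T) + of_bool (U = - T)"
      using ne by (auto simp: Delta_def axis_def)
  qed simp
  also have "\<dots> = of_bool (T \<in> V) + of_bool (- T \<in> V)"
    by (simp add: sum.distrib of_bool_def)
  finally show ?thesis
    using T by (auto simp: V_def)
qed

lemma keel_divisor_coeff:
  assumes T: "2 \<le> card T" "2 \<le> card (- T)" and I: "card I = 4"
  shows "keel_divisor I $ bd T = of_bool (card (I \<inter> T) = 2) / 3"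
proof -
  obtain i j k l where e: "I = {i, j, k, l}" "card {i, j, k, l} = 4"
    using I by (rule card_4_obtain)
  then have d: "i \<noteq> j" "i \<noteq> k" "i \<noteq> l" "j \<noteq> k" "j \<noteq> l" "k \<noteq> l"
    by (simp_all add: card4_iff)
  show ?thesis
    unfolding e(1) keel_divisor_eq[OF e(2)] using d
  proof (cases "i \<in> T"; cases "j \<in> T"; cases "k \<in> T"; cases "l \<in> T")
  qed (simp_all add: separating_coeff[OF T] Int_insert_left)

qed

text \<open>
  The three divisors whose average is \<open>keel_divisor I\<close> are linearly equivalent, and the
  intersection number of each with the curve is the degree of the map to the space of stable
  4-pointed curves that forgets the points outside \<open>I\<close>.
\<close>

lemma pairing_keel_divisor:
  assumes P: "four_parts P" and I: "card I = 4"
  shows "pairing P (keel_divisor I) = of_bool (\<forall>A\<in>P. A \<inter> I \<noteq> {})"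
proof -
  obtain i j k l where e: "I = {i, j, k, l}" "card {i, j, k, l} = 4"
    using I by (rule card_4_obtain)
  then have c: "card {i, k, j, l} = 4" "card {i, l, j, k} = 4"
    by (simp_all add: insert_commute)
  have s: "{i, k, j, l} = I" "{i, l, j, k} = I"
    using e(1) by auto
  show ?thesis
    unfolding e(1) keel_divisor_eq[OF e(2)]
    by (simp add: pairing_scale pairing_add pairing_separating[OF P e(2)] pairing_separating[OF P c(1)]
        pairing_separating[OF P c(2)] s flip: e(1))
qed

section \<open>Curves whose partition splits both sides of a boundary divisor\<close>

definition splitting :: "7 set \<Rightarrow> 7 \<Rightarrow> 7 set \<Rightarrow> 7 set set" where
  "splitting J y X = {{y}, J - {y}, X, - J - X}"

lemma four_parts_splitting:
  assumes "y \<in> J" "2 \<le> card J" "X \<subseteq> - J" "X \<noteq> {}" "card X < card (- J)"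
  shows "four_parts (splitting J y X)"
proof -
  have "J - {y} \<noteq> {}"
  proof
    assume "J - {y} = {}"
    then have "card (J - {y}) = 0" by (simp only: card.empty)
    then show False using assms(1,2) by simp
  qed
  moreover have "- J - X \<noteq> {}"
  proof
    assume "- J - X = {}"
    then have "X = - J" using assms(3) by blast
    then show False using assms(5) by simp
  qed
  moreover have "card (splitting J y X) = 4" if "z \<in> J - {y}" "x \<in> X" "w \<in> - J - X" for z x w
  proof -
    have "y \<notin> X" "z \<notin> X" "x \<notin> J"
      using that assms(1,3) by blast+
    then show ?thesis
      unfolding splitting_def card4_iff using that assms(1) by auto
  qed
  moreover have "partition_on UNIV (splitting J y X)" if "J - {y} \<noteq> {}" "- J - X \<noteq> {}"
  proof (rule partition_onI)
    show "\<Union> (splitting J y X) = UNIV"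
      unfolding splitting_def using assms(1,3) by auto
    show "disjnt A B" if "A \<in> splitting J y X" "B \<in> splitting J y X" "A \<noteq> B" for A B
      using that assms(1,3) unfolding splitting_def disjnt_def by (elim insertE emptyE) blast+
    show "{} \<notin> splitting J y X"
      using that assms(4) unfolding splitting_def by blast
  qed
  ultimately show ?thesis
    using assms(4) unfolding four_parts_def by blast
qed

lemma card_subsets_between:
  assumes "finite K" "A \<subseteq> K" "B \<subseteq> K" "A \<inter> B = {}" "card A \<le> m"
  shows "card {X. X \<subseteq> K \<and> card X = m \<and> A \<subseteq> X \<and> X \<inter> B = {}} = (card K - card A - card B) choose (m - card A)"
proof -
  have fin: "finite A" "finite B"
    using assms(1-3) finite_subset by auto
  have "bij_betw ((\<union>) A) {Z. Z \<subseteq> K - A - B \<and> card Z = m - card A}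
      {X. X \<subseteq> K \<and> card X = m \<and> A \<subseteq> X \<and> X \<inter> B = {}}"
  proof (rule bij_betw_byWitness[where f' = "\<lambda>X. X - A"])
    show "(\<union>) A ` {Z. Z \<subseteq> K - A - B \<and> card Z = m - card A} \<subseteq>
        {X. X \<subseteq> K \<and> card X = m \<and> A \<subseteq> X \<and> X \<inter> B = {}}"
    proof (intro image_subsetI CollectI)
      fix Z assume Z: "Z \<in> {Z. Z \<subseteq> K - A - B \<and> card Z = m - card A}"
      then have "finite Z" "A \<inter> Z = {}"
        using assms(1) finite_subset by blast+
      then have "card (A \<union> Z) = m"
        using Z fin assms(5) by (simp add: card_Un_disjoint)
      with Z assms show "A \<union> Z \<subseteq> K \<and> card (A \<union> Z) = m \<and> A \<subseteq> A \<union> Z \<and> (A \<union> Z) \<inter> B = {}"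
        by blast
    qed
    show "(\<lambda>X. X - A) ` {X. X \<subseteq> K \<and> card X = m \<and> A \<subseteq> X \<and> X \<inter> B = {}} \<subseteq>
        {Z. Z \<subseteq> K - A - B \<and> card Z = m - card A}"
      using fin by (auto simp: card_Diff_subset)
    show "\<forall>Z\<in>{Z. Z \<subseteq> K - A - B \<and> card Z = m - card A}. (A \<union> Z) - A = Z"
      by blast
    show "\<forall>X\<in>{X. X \<subseteq> K \<and> card X = m \<and> A \<subseteq> X \<and> X \<inter> B = {}}. A \<union> (X - A) = X"
      by blast
  qed
  then have "card {X. X \<subseteq> K \<and> card X = m \<and> A \<subseteq> X \<and> X \<inter> B = {}} =
      card {Z. Z \<subseteq> K - A - B \<and> card Z = m - card A}"
    by (rule bij_betw_same_card[symmetric])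
  also have "\<dots> = card (K - A - B) choose (m - card A)"
    using assms(1) by (simp add: n_subsets)
  also have "card (K - A - B) = card K - card A - card B"
  proof -
    have "B \<subseteq> K - A" using assms by blast
    then show ?thesis using fin assms(2) by (simp add: card_Diff_subset)
  qed
  finally show ?thesis .
qed

text \<open>
  Different pairs \<open>(y, X)\<close> can give the same partition: both \<open>y\<close> do if \<open>card J = 2\<close>, and both halves
  \<open>X\<close> of \<open>- J\<close> do if \<open>card (- J) = 2 * m\<close>. Its curve is then counted repeatedly.
\<close>

definition splitting_sum :: "nat \<Rightarrow> 7 set \<Rightarrow> divisor \<Rightarrow> rat" where
  "splitting_sum m J D = (\<Sum>y\<in>J. \<Sum>X | X \<subseteq> - J \<and> card X = m. pairing (splitting J y X) D)"

text \<open>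
  A term contributes only if each of its four parts contains a point of \<open>I\<close>. This forces
  \<open>card (I \<inter> J) = 2\<close>; then \<open>y\<close> is one of the two points of \<open>I \<inter> J\<close>, and \<open>X\<close> contains exactly one of the two points of \<open>I - J\<close>.
\<close>

lemma splitting_sum_keel_divisor:
  assumes J: "2 \<le> card J" and m: "0 < m" "m < card (- J)" and I: "card I = 4"
  shows "splitting_sum m J (keel_divisor I) =
    of_bool (card (I \<inter> J) = 2) * (4 * of_nat ((card (- J) - 2) choose (m - 1)))"
proof -
  have val: "pairing (splitting J y X) (keel_divisor I) = of_bool
      (y \<in> I \<and> (J - {y}) \<inter> I \<noteq> {} \<and> X \<inter> I \<noteq> {} \<and> (- J - X) \<inter> I \<noteq> {})"
    if "y \<in> J" "X \<subseteq> - J" "card X = m" for y X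
  proof -
    have "X \<noteq> {}" using that m by auto
    then have "four_parts (splitting J y X)"
      using that J m by (intro four_parts_splitting) simp_all
    then show ?thesis
      by (subst pairing_keel_divisor[OF _ I]) (simp_all add: splitting_def)
  qed
  have IJ: "card (I \<inter> J) + card (I - J) = 4"
    using card_Int_Diff[of I J] I by simp
  show ?thesis
  proof (cases "card (I \<inter> J) = 2")
    case True
    then have "card (I - J) = 2" using IJ by simp
    then obtain c d where cd: "I - J = {c, d}" "c \<noteq> d"
      by (auto simp: card_2_iff)
    obtain a b where ab: "I \<inter> J = {a, b}" "a \<noteq> b"
      using True by (auto simp: card_2_iff)
    have sub: "{c, d} \<subseteq> - J" "{a, b} \<subseteq> J"
      using cd ab by blast+
    have count: "(\<Sum>X | X \<subseteq> - J \<and> card X = m. of_bool ({x} \<subseteq> X \<and> X \<inter> {x'} = {})) =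
        (of_nat ((card (- J) - 2) choose (m - 1)) :: rat)"
      if "x \<in> - J" "x' \<in> - J" "x \<noteq> x'" for x x'
    proof -
      have "{X. X \<subseteq> - J \<and> card X = m} \<inter> {X. {x} \<subseteq> X \<and> X \<inter> {x'} = {}} =
          {X. X \<subseteq> - J \<and> card X = m \<and> {x} \<subseteq> X \<and> X \<inter> {x'} = {}}"
        by blast
      then show ?thesis
        using card_subsets_between[of "- J" "{x}" "{x'}" m] that m(1)
        by (simp only: sum_of_bool_eq finite) (simp add: numeral_2_eq_2)
    qed
    have "pairing (splitting J y X) (keel_divisor I) = of_bool (y \<in> {a, b}) *
        (of_bool ({c} \<subseteq> X \<and> X \<inter> {d} = {}) + of_bool ({d} \<subseteq> X \<and> X \<inter> {c} = {}))"
      if y: "y \<in> J" and X: "X \<subseteq> - J" "card X = m" for y X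
    proof -
      have "y \<in> I \<longleftrightarrow> y \<in> {a, b}"
        using y ab(1) by blast
      moreover have "(J - {y}) \<inter> I = {a, b} - {y}"
        using ab(1) by blast
      then have "(J - {y}) \<inter> I \<noteq> {}"
        using ab(2) by auto
      moreover have "X \<inter> I = X \<inter> {c, d}" "(- J - X) \<inter> I = {c, d} - X"
        using X(1) cd(1) by blast+
      ultimately show ?thesis
        unfolding val[OF y X] by (cases "c \<in> X"; cases "d \<in> X") auto
    qed
    then have "splitting_sum m J (keel_divisor I) = (\<Sum>y\<in>J. \<Sum>X | X \<subseteq> - J \<and> card X = m. of_bool (y \<in> {a, b}) *
        (of_bool ({c} \<subseteq> X \<and> X \<inter> {d} = {}) + of_bool ({d} \<subseteq> X \<and> X \<inter> {c} = {})))"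
      unfolding splitting_sum_def by (intro sum.cong) auto
    also have "\<dots> = (\<Sum>y\<in>J. of_bool (y \<in> {a, b})) *
      ((\<Sum>X | X \<subseteq> - J \<and> card X = m. of_bool ({c} \<subseteq> X \<and> X \<inter> {d} = {})) +
       (\<Sum>X | X \<subseteq> - J \<and> card X = m. of_bool ({d} \<subseteq> X \<and> X \<inter> {c} = {})))"
      by (simp only: sum_distrib_left[symmetric] sum_distrib_right[symmetric] sum.distrib)
    also have "(\<Sum>y\<in>J. of_bool (y \<in> {a, b})) = (2 :: rat)"
    proof -
      have "J \<inter> {y. y \<in> {a, b}} = {a, b}" using sub(2) by blast
      then show ?thesis using ab(2) by (simp only: sum_of_bool_eq finite) simp
    qed
    finally show ?thesis
      using True count[of c d] count[of d c] sub cd(2) by simp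
  next
    case False
    have "pairing (splitting J y X) (keel_divisor I) = 0"
      if y: "y \<in> J" and X: "X \<subseteq> - J" "card X = m" for y X
    proof -
      have "\<not> (y \<in> I \<and> (J - {y}) \<inter> I \<noteq> {} \<and> X \<inter> I \<noteq> {} \<and> (- J - X) \<inter> I \<noteq> {})"
      proof
        assume "y \<in> I \<and> (J - {y}) \<inter> I \<noteq> {} \<and> X \<inter> I \<noteq> {} \<and> (- J - X) \<inter> I \<noteq> {}"
        then obtain z u v where "{y, z} \<subseteq> I \<inter> J" "{u, v} \<subseteq> I - J" "y \<noteq> z" "u \<noteq> v"
          using y X(1) by blast
        then have "2 \<le> card (I \<inter> J)" "2 \<le> card (I - J)"
          using card_mono[of "I \<inter> J" "{y, z}"] card_mono[of "I - J" "{u, v}"] by simp_all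
        with IJ False show False by linarith
      qed
      then show ?thesis
        unfolding val[OF y X] by (simp only: of_bool_eq)
    qed
    with False show ?thesis
      unfolding splitting_sum_def by simp
  qed
qed

text \<open>
  The bound \<open>m + 2 \<le> card (- J)\<close> keeps \<open>- J - X\<close> from being a singleton part. A pair inside \<open>J\<close> consists
  of two singleton parts if \<open>card J = 2\<close> and is the part \<open>J - {y}\<close> for one \<open>y\<close> if \<open>card J = 3\<close>; a pair
  across consists of two singleton parts for \<open>X = {j}\<close>; a pair outside is \<open>X\<close> or \<open>- J - X\<close>.
\<close>

lemma splitting_sum_Delta_pair:
  assumes J: "card J = 2 \<or> card J = 3" and m: "0 < m" "m + 2 \<le> card (- J)" and ij: "i \<noteq> j"
  shows splitting_sum_Delta_inside: "i \<in> J \<Longrightarrow> j \<in> J \<Longrightarrow> splitting_sum m J (Delta {i, j}) =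
      (if card J = 2 then 2 else - 1) * of_nat (card (- J) choose m)"
    and splitting_sum_Delta_across: "i \<in> J \<Longrightarrow> j \<notin> J \<Longrightarrow> splitting_sum m J (Delta {i, j}) =
      (if card J = 2 then 2 else 1) * of_bool (m = 1)"
    and splitting_sum_Delta_outside: "i \<notin> J \<Longrightarrow> j \<notin> J \<Longrightarrow> splitting_sum m J (Delta {i, j}) =
      - of_nat (card J) * (of_bool (m = 2) + of_bool (card (- J) = m + 2))"
proof -
  have val: "pairing (splitting J y X) (Delta {i, j}) =
      of_bool ({i} \<in> splitting J y X \<and> {j} \<in> splitting J y X) - of_bool ({i, j} \<in> splitting J y X)"
    if "y \<in> J" "X \<subseteq> - J" "card X = m" for y X
  proof -
    have "X \<noteq> {}" using that m by auto
    then have "four_parts (splitting J y X)"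
      using that J m by (intro four_parts_splitting) auto
    then show ?thesis
      unfolding Delta_def pairing_axis by (rule branch_number_pair[OF _ ij])
  qed
  have single_in: "{x} \<in> splitting J y X \<longleftrightarrow> x = y \<or> card J = 2"
    if "y \<in> J" "X \<subseteq> - J" "x \<in> J" for x y X
  proof -
    have "J - {y} = {x} \<longleftrightarrow> x \<noteq> y \<and> card J = 2"
    proof
      assume e: "J - {y} = {x}"
      then have "card (J - {y}) = 1" by simp
      moreover have "x \<in> J - {y}"
        by (simp add: e)
      ultimately show "x \<noteq> y \<and> card J = 2"
        using that(1) J by auto
    next
      assume "x \<noteq> y \<and> card J = 2"
      then show "J - {y} = {x}"
        using that(1,3) by (intro card_seteq[symmetric]) auto
    qed
    moreover have "{x} \<noteq> X" "{x} \<noteq> - J - X"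
      using that(2,3) by blast+
    ultimately show ?thesis
      unfolding splitting_def by auto
  qed
  have card_rest: "card (- J - X) = card (- J) - m" if "X \<subseteq> - J" "card X = m" for X
    using that by (simp add: card_Diff_subset)
  have single_out: "{x} \<in> splitting J y X \<longleftrightarrow> X = {x}"
    if "y \<in> J" "X \<subseteq> - J" "card X = m" "x \<notin> J" for x y X
  proof -
    have "- J - X \<noteq> {x}"
      using card_rest[OF that(2,3)] m by auto
    then show ?thesis
      using that unfolding splitting_def by auto
  qed
  have pair_in: "{i, j} \<in> splitting J y X \<longleftrightarrow> card J = 3 \<and> y \<noteq> i \<and> y \<noteq> j"
    if "y \<in> J" "X \<subseteq> - J" "i \<in> J" "j \<in> J" for y X
  proof -
    have "J - {y} = {i, j} \<longleftrightarrow> card J = 3 \<and> y \<noteq> i \<and> y \<noteq> j"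
    proof
      assume e: "J - {y} = {i, j}"
      then have "card (J - {y}) = 2" using ij by simp
      moreover have "i \<in> J - {y}" "j \<in> J - {y}"
        by (simp_all add: e)
      ultimately show "card J = 3 \<and> y \<noteq> i \<and> y \<noteq> j"
        using that(1) J by auto
    next
      assume "card J = 3 \<and> y \<noteq> i \<and> y \<noteq> j"
      then show "J - {y} = {i, j}"
        using that ij by (intro card_seteq[symmetric]) auto
    qed
    moreover have "{i, j} \<noteq> {y}" "{i, j} \<noteq> X" "{i, j} \<noteq> - J - X"
      using that ij by blast+
    ultimately show ?thesis
      unfolding splitting_def by (metis insert_iff empty_iff)
  qed
  show "splitting_sum m J (Delta {i, j}) = (if card J = 2 then 2 else - 1) * of_nat (card (- J) choose m)"
    if ij': "i \<in> J" "j \<in> J"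
  proof -
    have "pairing (splitting J y X) (Delta {i, j}) = of_bool (card J = 2) - of_bool (card J = 3 \<and> y \<in> J - {i, j})"
      if y: "y \<in> J" and X: "X \<subseteq> - J" "card X = m" for y X
    proof -
      have "{i} \<in> splitting J y X \<and> {j} \<in> splitting J y X \<longleftrightarrow> card J = 2"
        using single_in[OF y X(1)] ij' ij by metis
      moreover have "{i, j} \<in> splitting J y X \<longleftrightarrow> card J = 3 \<and> y \<in> J - {i, j}"
        unfolding pair_in[OF y X(1) ij'] using y by blast
      ultimately show ?thesis
        unfolding val[OF y X] by (simp only:)
    qed
    then have "splitting_sum m J (Delta {i, j}) = (\<Sum>y\<in>J. \<Sum>X | X \<subseteq> - J \<and> card X = m.
        of_bool (card J = 2) - of_bool (card J = 3 \<and> y \<in> J - {i, j}))"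
      unfolding splitting_sum_def by (intro sum.cong) auto
    also have "\<dots> = of_nat (card (- J) choose m) *
        (\<Sum>y\<in>J. of_bool (card J = 2) - of_bool (card J = 3 \<and> y \<in> J - {i, j}))"
      by (simp add: n_subsets sum_distrib_left)
    also have "(\<Sum>y\<in>J. of_bool (card J = 2) - of_bool (card J = 3 \<and> y \<in> J - {i, j})) =
        (if card J = 2 then 2 else - 1 :: rat)"
    proof -
      have "(\<Sum>y\<in>J. of_bool (y \<in> J - {i, j})) = (of_nat (card J - 2) :: rat)"
      proof -
        have "J \<inter> {y. y \<in> J - {i, j}} = J - {i, j}" by blast
        then show ?thesis
          using that ij by (simp only: sum_of_bool_eq finite) (simp add: card_Diff_subset)
      qed
      then show ?thesis using J by (auto simp: sum_negf)
    qed
    finally show ?thesis by simp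
  qed
  show "splitting_sum m J (Delta {i, j}) = (if card J = 2 then 2 else 1) * of_bool (m = 1)"
    if ij': "i \<in> J" "j \<notin> J"
  proof -
    have "pairing (splitting J y X) (Delta {i, j}) = of_bool (y = i \<or> card J = 2) * of_bool (X = {j})"
      if y: "y \<in> J" and X: "X \<subseteq> - J" "card X = m" for y X
    proof -
      have "{i, j} \<notin> splitting J y X"
        using ij' y X(1) unfolding splitting_def by blast
      then show ?thesis
        using val[OF y X] single_in[OF y X(1) ij'(1)] single_out[OF y X ij'(2)] by auto
    qed
    then have "splitting_sum m J (Delta {i, j}) =
        (\<Sum>y\<in>J. \<Sum>X | X \<subseteq> - J \<and> card X = m. of_bool (y = i \<or> card J = 2) * of_bool (X = {j}))"
      unfolding splitting_sum_def by (intro sum.cong) auto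
    also have "\<dots> = (\<Sum>y\<in>J. of_bool (y = i \<or> card J = 2)) * (\<Sum>X | X \<subseteq> - J \<and> card X = m. of_bool (X = {j}))"
      by (simp only: sum_distrib_left[symmetric] sum_distrib_right[symmetric])
    also have "(\<Sum>X | X \<subseteq> - J \<and> card X = m. of_bool (X = {j})) = (of_bool (m = 1) :: rat)"
      using ij'(2) by (simp add: of_bool_def)
    also have "(\<Sum>y\<in>J. of_bool (y = i \<or> card J = 2)) = (if card J = 2 then 2 else 1 :: rat)"
      using ij'(1) by (cases "card J = 2") (simp_all add: of_bool_def)
    finally show ?thesis .
  qed
  show "splitting_sum m J (Delta {i, j}) = - of_nat (card J) * (of_bool (m = 2) + of_bool (card (- J) = m + 2))"
    if ij': "i \<notin> J" "j \<notin> J"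
  proof -
    have "pairing (splitting J y X) (Delta {i, j}) = - (of_bool (X = {i, j}) + of_bool (X = - J - {i, j}))"
      if y: "y \<in> J" and X: "X \<subseteq> - J" "card X = m" for y X
    proof -
      have "- J - X = {i, j} \<longleftrightarrow> X = - J - {i, j}"
        using X(1) ij' by blast
      moreover have "{i, j} \<noteq> {y}" "{i, j} \<noteq> J - {y}"
        using ij' y by blast+
      ultimately have "{i, j} \<in> splitting J y X \<longleftrightarrow> X = {i, j} \<or> X = - J - {i, j}"
        unfolding splitting_def using \<open>- J - X = {i, j} \<longleftrightarrow> _\<close> by (metis insert_iff empty_iff)
      moreover have "X = {i, j} \<Longrightarrow> X \<noteq> - J - {i, j}"
        by auto
      moreover have "\<not> ({i} \<in> splitting J y X \<and> {j} \<in> splitting J y X)"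
        using single_out[OF y X ij'(1)] single_out[OF y X ij'(2)] ij by auto
      ultimately show ?thesis
        unfolding val[OF y X] by (cases "X = {i, j}") simp_all
    qed
    then have "splitting_sum m J (Delta {i, j}) = (\<Sum>y\<in>J. \<Sum>X | X \<subseteq> - J \<and> card X = m.
        - (of_bool (X = {i, j}) + of_bool (X = - J - {i, j})))"
      unfolding splitting_sum_def by (intro sum.cong) auto
    also have "\<dots> = - of_nat (card J) * ((\<Sum>X | X \<subseteq> - J \<and> card X = m. of_bool (X = {i, j})) +
        (\<Sum>X | X \<subseteq> - J \<and> card X = m. of_bool (X = - J - {i, j})))"
      by (simp only: sum_negf sum.distrib) (simp add: algebra_simps)
    also have "(\<Sum>X | X \<subseteq> - J \<and> card X = m. of_bool (X = {i, j})) = (of_bool (m = 2) :: rat)"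
      using ij' ij by (auto simp add: of_bool_def)
    also have "(\<Sum>X | X \<subseteq> - J \<and> card X = m. of_bool (X = - J - {i, j})) =
        (of_bool (card (- J) = m + 2) :: rat)"
    proof -
      have "{i, j} \<subseteq> - J" using ij' by blast
      then have "card (- J - {i, j}) = card (- J) - 2"
        using ij by (simp only: card_Diff_subset finite) simp
      then show ?thesis
        using m by (auto simp add: of_bool_def)
    qed
    finally show ?thesis .
  qed
qed

section \<open>The coefficient as a sum of intersection numbers\<close>

text \<open>
  The two weights in each case solve the linear system that consists of the vanishing of the defect,
  defined below, on \<open>keel_divisor I\<close> for \<open>card (I \<inter> J) = 2\<close> and its being the same on all \<open>Dpt i\<close>.
\<close>

definition curve_sum :: "7 set \<Rightarrow> divisor \<Rightarrow> rat" where
  "curve_sum J D =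
    (if card J = 2 then splitting_sum 1 J D / 30 + splitting_sum 2 J D / 60
     else splitting_sum 1 J D / 40 + 7 * splitting_sum 2 J D / 240)"

definition defect :: "7 set \<Rightarrow> divisor \<Rightarrow> rat" where
  "defect J D = D $ bd J - curve_sum J D"

lemma linear_splitting_sum: "Vector_Spaces.linear (*s) (*) (splitting_sum m J)"
  by unfold_locales
    (simp_all add: splitting_sum_def pairing_add pairing_scale sum.distrib sum_distrib_left algebra_simps)

lemma linear_defect: "Vector_Spaces.linear (*s) (*) (defect J)"
proof -
  interpret S: Vector_Spaces.linear "(*s)" "(*)" "splitting_sum m J" for m
    by (rule linear_splitting_sum)
  show ?thesis
    by unfold_locales (simp_all add: defect_def curve_sum_def S.add S.scale algebra_simps add_divide_distrib)
qed

locale small_side =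
  fixes J :: "7 set"
  assumes card_J: "card J = 2 \<or> card J = 3"
begin

lemma card_compl: "card (- J) = (if card J = 2 then 5 else 4)"
  using card_J by (auto simp: card_compl7)

lemma sides_large: "2 \<le> card J" "2 \<le> card (- J)"
  using card_J card_compl by auto

sublocale defect: Vector_Spaces.linear "(*s)" "(*)" "defect J"
  by (rule linear_defect)

lemma defect_keel_divisor:
  assumes "card I = 4"
  shows "defect J (keel_divisor I) = 0"
proof -
  have "splitting_sum m J (keel_divisor I) =
      of_bool (card (I \<inter> J) = 2) * (4 * of_nat ((card (- J) - 2) choose (m - 1)))" if "m = 1 \<or> m = 2" for m
    using that assms sides_large(1) card_compl by (intro splitting_sum_keel_divisor) auto
  then show ?thesis
    using card_J unfolding defect_def curve_sum_def keel_divisor_coeff[OF sides_large assms]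
    by (auto simp: card_compl)
qed

lemma Delta_pair_coeff:
  assumes "i \<noteq> j"
  shows "Delta {i, j} $ bd J = of_bool ({i, j} = J)"
proof -
  have "card {i, j} = 2" "card (- {i, j}) = 5"
    using assms by (simp_all add: card_compl7)
  then have "bd J = bd {i, j} \<longleftrightarrow> J = {i, j} \<or> J = - {i, j}"
    using sides_large by (intro bd_eq_iff) simp_all
  moreover have "J \<noteq> - {i, j}"
    using card_J \<open>card (- {i, j}) = 5\<close> by auto
  ultimately show ?thesis
    by (auto simp: Delta_def axis_def)
qed

text \<open>
  The weights do not distinguish points on the same side of \<open>J\<close>, so there are three positions of
  the pair to consider.
\<close>

lemma defect_Delta_pair:
  assumes "i \<noteq> j"
  shows "i \<in> J \<Longrightarrow> j \<in> J \<Longrightarrow> defect J (Delta {i, j}) = (if card J = 2 then 1 / 3 else 11 / 40)"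
    and "i \<in> J \<Longrightarrow> j \<notin> J \<Longrightarrow> defect J (Delta {i, j}) = (if card J = 2 then - 1 / 15 else - 1 / 40)"
    and "i \<notin> J \<Longrightarrow> j \<notin> J \<Longrightarrow> defect J (Delta {i, j}) = (if card J = 2 then 1 / 30 else 7 / 40)"
proof -
  have m: "m = 1 \<or> m = 2 \<Longrightarrow> 0 < m" "m = 1 \<or> m = 2 \<Longrightarrow> m + 2 \<le> card (- J)" for m :: nat
    using card_compl by auto
  have n: "(5 choose 2) = (10 :: nat)" "(4 choose 2) = (6 :: nat)"
    by (simp_all add: choose_two)
  {
    assume ij: "i \<in> J" "j \<in> J"
    have "{i, j} = J \<longleftrightarrow> card J = 2"
      using ij assms card_seteq[of J "{i, j}"] by auto
    then show "defect J (Delta {i, j}) = (if card J = 2 then 1 / 3 else 11 / 40)"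
      using splitting_sum_Delta_inside[OF card_J m assms ij, of 1]
        splitting_sum_Delta_inside[OF card_J m assms ij, of 2]
      unfolding defect_def curve_sum_def Delta_pair_coeff[OF assms] by (simp add: card_compl n)
  next
    assume ij: "i \<in> J" "j \<notin> J"
    then have "{i, j} \<noteq> J" by blast
    then show "defect J (Delta {i, j}) = (if card J = 2 then - 1 / 15 else - 1 / 40)"
      using splitting_sum_Delta_across[OF card_J m assms ij, of 1]
        splitting_sum_Delta_across[OF card_J m assms ij, of 2]
      unfolding defect_def curve_sum_def Delta_pair_coeff[OF assms] by (simp add: card_compl)
  next
    assume ij: "i \<notin> J" "j \<notin> J"
    then have "{i, j} \<noteq> J" by blast
    then show "defect J (Delta {i, j}) = (if card J = 2 then 1 / 30 else 7 / 40)"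
      using splitting_sum_Delta_outside[OF card_J m assms ij, of 1]
        splitting_sum_Delta_outside[OF card_J m assms ij, of 2] card_J
      unfolding defect_def curve_sum_def Delta_pair_coeff[OF assms] by (auto simp: card_compl)
  }
qed

text \<open>
  For \<open>i \<in> J\<close> this is \<open>1/3 - 5 * 1/15 = 0\<close> or \<open>2 * 11/40 - 4 * 1/40 = 9/20\<close>, and for \<open>i \<notin> J\<close> it is
  \<open>- 2 * 1/15 + 4 * 1/30 = 0\<close> or \<open>- 3 * 1/40 + 3 * 7/40 = 9/20\<close>. That the two agree is what the
  weights were chosen for.
\<close>

lemma defect_Dpt: "defect J (Dpt i) = (if card J = 2 then 0 else 9 / 20)"
proof -
  have split: "- {i} = (J - {i}) \<union> (- J - {i})" "(J - {i}) \<inter> (- J - {i}) = {}"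
    by blast+
  have "defect J (Dpt i) = (\<Sum>j\<in>- {i}. defect J (Delta {i, j}))"
    by (simp add: Dpt_def defect.sum)
  also have "\<dots> = (\<Sum>j\<in>J - {i}. defect J (Delta {i, j})) + (\<Sum>j\<in>- J - {i}. defect J (Delta {i, j}))"
    unfolding split(1) by (intro sum.union_disjoint) (use split(2) in simp_all)
  also have "\<dots> = (if card J = 2 then 0 else 9 / 20)"
  proof (cases "i \<in> J")
    case True
    have "(\<Sum>j\<in>J - {i}. defect J (Delta {i, j})) =
        (\<Sum>j\<in>J - {i}. if card J = 2 then 1 / 3 else 11 / 40)"
      using True by (intro sum.cong defect_Delta_pair(1)) auto
    moreover have "(\<Sum>j\<in>- J - {i}. defect J (Delta {i, j})) =
        (\<Sum>j\<in>- J. if card J = 2 then - 1 / 15 else - 1 / 40)"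
      using True by (intro sum.cong defect_Delta_pair(2)) auto
    ultimately show ?thesis
      using True card_J by (auto simp: card_compl)
  next
    case False
    have "(\<Sum>j\<in>J - {i}. defect J (Delta {i, j})) =
        (\<Sum>j\<in>J. if card J = 2 then - 1 / 15 else - 1 / 40)"
    proof (rule sum.cong)
      fix j assume j: "j \<in> J"
      then have "j \<noteq> i" using False by auto
      then show "defect J (Delta {i, j}) = (if card J = 2 then - 1 / 15 else - 1 / 40)"
        using defect_Delta_pair(2)[of j i] j False by (simp add: insert_commute)
    qed (use False in auto)
    moreover have "(\<Sum>j\<in>- J - {i}. defect J (Delta {i, j})) =
        (\<Sum>j\<in>- J - {i}. if card J = 2 then 1 / 30 else 7 / 40)"
      using False by (intro sum.cong defect_Delta_pair(3)) auto
    ultimately show ?thesis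
      using False card_J by (auto simp: card_compl)
  qed
  finally show ?thesis .
qed

end

section \<open>Relations between the symmetric divisors\<close>

lemma boundary_small_side:
  obtains J where "K = bd J" "small_side J"
proof -
  obtain T where T: "K = bd T" "2 \<le> card T" "2 \<le> card (- T)"
    by (rule boundary_cases)
  show thesis
  proof (cases "card T \<le> 3")
    case True
    then have "small_side T"
      using T(2) unfolding small_side_def by linarith
    with T(1) show thesis by (rule that)
  next
    case False
    then have "small_side (- T)"
      using T(3) card_compl7[of T] unfolding small_side_def by linarith
    with T(1) show thesis
      by (intro that[of "- T"]) (simp_all add: bd_compl)
  qed
qed

lemma sum_Delta_coeff:
  assumes J: "small_side J" and k: "k \<in> {2, 3}"
  shows "(\<Sum>T | card T = k. Delta T) $ bd J = of_bool (card J = k)"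
proof -
  interpret small_side J by fact
  have "(\<Sum>T | card T = k. Delta T) $ bd J = (\<Sum>T | card T = k. of_bool (T = J))"
    unfolding sum_component
  proof (rule sum.cong)
    fix T :: "7 set" assume "T \<in> {T. card T = k}"
    then have T: "card T = k" "card (- T) = 7 - k"
      by (simp_all add: card_compl7)
    then have "bd J = bd T \<longleftrightarrow> J = T \<or> J = - T"
      using sides_large k by (intro bd_eq_iff) auto
    moreover have "J \<noteq> - T"
      using card_J T k by auto
    ultimately show "Delta T $ bd J = of_bool (T = J)"
      by (auto simp: Delta_def axis_def)
  qed simp
  also have "\<dots> = of_bool (card J = k)"
    by (simp add: of_bool_def)
  finally show ?thesis .
qed

lemma sum_Dpt: "(\<Sum>i\<in>UNIV. Dpt i) = 2 *s B2"
proof (rule vec_eq_iff[THEN iffD2], rule allI)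
  fix K
  obtain J where K: "K = bd J" "small_side J"
    by (rule boundary_small_side)
  interpret small_side J by fact
  have "Dpt i $ K = of_bool (card J = 2 \<and> i \<in> J)" for i
  proof -
    have "Dpt i $ K = (\<Sum>j\<in>- {i}. of_bool ({i, j} = J))"
      unfolding Dpt_def sum_component K(1) by (intro sum.cong Delta_pair_coeff) auto
    also have "\<dots> = of_bool (card J = 2 \<and> i \<in> J)"
    proof (cases "card J = 2 \<and> i \<in> J")
      case True
      then obtain k where k: "J = {i, k}" "i \<noteq> k"
        by (metis card_2_iff doubleton_eq_iff insertE singletonD)
      then have "{i, j} = J \<longleftrightarrow> j = k" for j
        by (simp add: doubleton_eq_iff)
      with True k(2) show ?thesis by (simp add: of_bool_def)
    next
      case False
      then have "{i, j} \<noteq> J" if "j \<in> - {i}" for j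
        using that by auto
      with False show ?thesis
        by (auto intro!: sum.neutral)
    qed
    finally show ?thesis .
  qed
  moreover have "B2 $ K = of_bool (card J = 2)"
    unfolding B2_def K(1) by (intro sum_Delta_coeff K(2)) simp
  ultimately show "(\<Sum>i\<in>UNIV. Dpt i) $ K = (2 *s B2) $ K"
    by (auto simp: sum_component)
qed

text \<open>
  The coefficient at \<open>\<Delta>\<^sub>J\<close> is a third of the number of ways to choose two points on each side: \<open>1 * 10\<close>
  ways if \<open>card J = 2\<close> and \<open>3 * 6\<close> if \<open>card J = 3\<close>.
\<close>

lemma sum_keel_divisor: "(\<Sum>I | card I = 4. keel_divisor I) = (10 / 3) *s B2 + 6 *s B3"
proof (rule vec_eq_iff[THEN iffD2], rule allI)
  fix K
  obtain J where K: "K = bd J" "small_side J"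
    by (rule boundary_small_side)
  interpret small_side J by fact
  have "bij_betw (\<lambda>(A, B). A \<union> B) ({A. A \<subseteq> J \<and> card A = 2} \<times> {B. B \<subseteq> - J \<and> card B = 2})
      {I. card I = 4 \<and> card (I \<inter> J) = 2}"
  proof (rule bij_betw_byWitness[where f' = "\<lambda>I. (I \<inter> J, I - J)"])
    show "(\<lambda>(A, B). A \<union> B) ` ({A. A \<subseteq> J \<and> card A = 2} \<times> {B. B \<subseteq> - J \<and> card B = 2}) \<subseteq>
        {I. card I = 4 \<and> card (I \<inter> J) = 2}"
    proof clarify
      fix A B assume A: "A \<subseteq> J" "card A = 2" and B: "B \<subseteq> - J" "card B = 2"
      then have "A \<inter> B = {}" "(A \<union> B) \<inter> J = A" by blast+
      with A B show "card (A \<union> B) = 4 \<and> card ((A \<union> B) \<inter> J) = 2"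
        by (simp add: card_Un_disjoint)
    qed
    show "(\<lambda>I. (I \<inter> J, I - J)) ` {I. card I = 4 \<and> card (I \<inter> J) = 2} \<subseteq>
        {A. A \<subseteq> J \<and> card A = 2} \<times> {B. B \<subseteq> - J \<and> card B = 2}"
    proof (rule image_subsetI)
      fix I assume I: "I \<in> {I. card I = 4 \<and> card (I \<inter> J) = 2}"
      then have "card (I - J) = 2"
        using card_Int_Diff[of I J] by simp
      with I show "(I \<inter> J, I - J) \<in> {A. A \<subseteq> J \<and> card A = 2} \<times> {B. B \<subseteq> - J \<and> card B = 2}"
        by auto
    qed
  qed auto
  then have "card {I. card I = 4 \<and> card (I \<inter> J) = 2} = (card J choose 2) * (card (- J) choose 2)"
    by (simp only: bij_betw_same_card[symmetric] card_cartesian_product n_subsets[OF finite])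
  moreover have "(\<Sum>I | card I = 4. keel_divisor I) $ K = of_nat (card {I. card I = 4 \<and> card (I \<inter> J) = 2}) / 3"
  proof -
    have "(\<Sum>I | card I = 4. keel_divisor I) $ K = (\<Sum>I | card I = 4. of_bool (card (I \<inter> J) = 2) / 3)"
      unfolding sum_component K(1) by (intro sum.cong keel_divisor_coeff sides_large) simp_all
    also have "\<dots> = of_nat (card {I. card I = 4 \<and> card (I \<inter> J) = 2}) / 3"
      by (simp add: Int_def flip: sum_divide_distrib)
    finally show ?thesis .
  qed
  moreover have "B2 $ K = of_bool (card J = 2)" "B3 $ K = of_bool (card J = 3)"
    unfolding B2_def B3_def K(1) by (intro sum_Delta_coeff K(2); simp)+
  ultimately show "(\<Sum>I | card I = 4. keel_divisor I) $ K = ((10 / 3) *s B2 + 6 *s B3) $ K"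
    using card_J by (auto simp: card_compl choose_two)
qed

section \<open>Effectivity\<close>

context small_side
begin

text \<open>
  As the defects of all \<open>Dpt i\<close> agree, the two relations determine those of \<open>B2\<close> and \<open>B3\<close>; the
  common factor is scaled so that they become \<open>18 * \<kappa>\<close>, \<open>63 * \<kappa>\<close> and \<open>- 35 * \<kappa>\<close>.
\<close>

lemma defect_Pdiv:
  assumes "18 * \<alpha> + 63 * lam - 35 * \<mu> = 0"
  shows "defect J (Pdiv \<alpha> lam \<mu> i) = 0"
proof -
  define \<kappa> where "\<kappa> = (if card J = 2 then 0 else 1 / 40 :: rat)"
  have D: "defect J (Dpt i) = 18 * \<kappa>" for i
    by (simp add: defect_Dpt \<kappa>_def)
  have "7 * (18 * \<kappa>) = defect J (\<Sum>i\<in>UNIV. Dpt i)"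
    unfolding defect.sum D by simp
  then have B2: "defect J B2 = 63 * \<kappa>"
    by (simp add: sum_Dpt defect.scale)
  have "0 = defect J (\<Sum>I | card I = 4. keel_divisor I)"
    unfolding defect.sum by (simp add: defect_keel_divisor)
  then have B3: "defect J B3 = - 35 * \<kappa>"
    by (simp add: sum_keel_divisor defect.add defect.scale B2)
  have "defect J (Pdiv \<alpha> lam \<mu> i) = \<alpha> * (18 * \<kappa>) + lam * (63 * \<kappa>) + \<mu> * (- 35 * \<kappa>)"
    by (simp only: Pdiv_def defect.add defect.scale D B2 B3)
  also have "\<dots> = (18 * \<alpha> + 63 * lam - 35 * \<mu>) * \<kappa>"
    by algebra
  finally show ?thesis
    by (simp add: assms)
qed

lemma F_nef_curve_sum_nonneg:
  assumes "F_nef (cls D)"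
  shows "0 \<le> curve_sum J D"
proof -
  have "0 \<le> splitting_sum m J D" if m: "m = 1 \<or> m = 2" for m
    unfolding splitting_sum_def
  proof (intro sum_nonneg)
    fix y X assume y: "y \<in> J" and X: "X \<in> {X. X \<subseteq> - J \<and> card X = m}"
    have "X \<noteq> {}" using X m by auto
    then have P: "four_parts (splitting J y X)"
      using y X m sides_large card_compl by (intro four_parts_splitting) auto
    then have "F_number (splitting J y X) \<in> F_curves"
      unfolding F_curves_eq four_parts_def by blast
    then show "0 \<le> pairing (splitting J y X) D"
      using assms unfolding F_nef_def by (simp flip: F_number_cls[OF P])
  qed
  from this[of 1] this[of 2] show ?thesis
    by (simp add: curve_sum_def)
qed

end

theorem proposition3p3:
  fixes \<alpha> lam \<mu> :: rat
    and d :: NS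
    and s :: "7 set \<Rightarrow> rat"
    and p :: "7 \<Rightarrow> rat"
  assumes "\<alpha> > 0"
    and "9 * \<alpha> + 27 * lam - 15 * \<mu> \<ge> 0"
    and "18 * \<alpha> + 63 * lam - 35 * \<mu> = 0"
    and "F_nef d"
    and "d \<in> NS.span ({cls (keel_divisor I) | I. card I = 4} \<union> range (\<lambda>i. cls (Pdiv \<alpha> lam \<mu> i)))"
    and "d = (\<Sum>I | card I = 4. s I *N cls (keel_divisor I)) + (\<Sum>i\<in>UNIV. p i *N cls (Pdiv \<alpha> lam \<mu> i))"
  shows "\<forall>J. 0 \<le> ((\<Sum>I | card I = 4. s I *s keel_divisor I) + (\<Sum>i\<in>UNIV. p i *s Pdiv \<alpha> lam \<mu> i)) $ J"
proof
  fix K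
  define D where "D = (\<Sum>I | card I = 4. s I *s keel_divisor I) + (\<Sum>i\<in>UNIV. p i *s Pdiv \<alpha> lam \<mu> i)"
  interpret cls: Vector_Spaces.linear "(*s)" nscale cls
    by (rule linear_cls)
  have d: "d = cls D"
    unfolding D_def assms(6) by (simp add: cls.add cls.sum cls.scale)
  obtain J where K: "K = bd J" "small_side J"
    by (rule boundary_small_side)
  interpret small_side J by fact
  have "defect J D = 0"
    unfolding D_def defect.add defect.sum defect.scale
    by (simp add: defect_keel_divisor defect_Pdiv[OF assms(3)])
  then have "D $ K = curve_sum J D"
    by (simp add: defect_def K(1))
  also have "0 \<le> \<dots>"
    using F_nef_curve_sum_nonneg assms(4) unfolding d .
  finally show "0 \<le> ((\<Sum>I | card I = 4. s I *s keel_divisor I) + (\<Sum>i\<in>UNIV. p i *s Pdiv \<alpha> lam \<mu> i)) $ K"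
    unfolding D_def .
qed

end
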